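(* Let $f$ be a homeomorphism of the two-torus $\mathbb{T}^2$. If the maximal equicontinuous factor of $(\mathbb{T}^2,f)$ is minimal, then it is, up to conjugacy, one of the following three: (i) an irrational translation on the two-torus; (ii) an irrational rotation on the circle; (iii) the identity on a singleton.
   Context: $\mathbb{T}^2=\mathbb{R}^2/\mathbb{Z}^2$. The homeomorphism $f$ is regarded as the $\mathbb{Z}$-action $n\mapsto f^n$. For a homeomorphism $f$ of a compact Hausdorff space $X$ there is a smallest closed (in $X\times X$) equivalence relation $S_{eq}$ that is invariant under $f$ and $f^{-1}$ (that is, $(x,y)\in S_{eq}$ if and only if $(f(x),f(y))\in S_{eq}$) such that the homeomorphism induced by $f$ on the quotient space $X/S_{eq}$ is equicontinuous (i.e. its iterates $n\in\mathbb{Z}$ form an equicontinuous family); this quotient system is the maximal equicontinuous factor (MEF) of $(X,f)$. A system is minimal if every orbit is dense. Two homeomorphisms $g\colon Y\to Y$ and $g'\colon Y'\to Y'$ are conjugate if there is a homeomorphism $\phi\colon Y\to Y'$ with $\phi\circ g=g'\circ\phi$. An irrational translation of the two-torus is a map $x\mapsto x+\alpha$ on $\mathbb{T}^2$, $\alpha=(\alpha_1,\alpha_2)$, with $1,\alpha_1,\alpha_2$ linearly independent over $\mathbb{Q}$ (equivalently, a minimal translation); an irrational rotation of the circle is a map $x\mapsto x+\alpha$ on $\mathbb{R}/\mathbb{Z}$ with $\alpha$ irrational. *)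

theory Defs
  imports "HOL-Analysis.Analysis"
begin

(* The points of the quotient space are the equivalence classes themselves; a set of classes is
   open iff its preimage under the projection x |-> R `` {x} is open. *)
definition quotient_topology :: "'a topology \<Rightarrow> ('a \<times> 'a) set \<Rightarrow> 'a set topology" where
  "quotient_topology X R =
     topology (\<lambda>U. U \<subseteq> topspace X // R \<and> openin X {x \<in> topspace X. R `` {x} \<in> U})"

lemma istopology_quotient_topology:
  "istopology (\<lambda>U. U \<subseteq> topspace X // R \<and> openin X {x \<in> topspace X. R `` {x} \<in> U})"
proof -
  have "openin X {x \<in> topspace X. R `` {x} \<in> S \<inter> T}"
    if "openin X {x \<in> topspace X. R `` {x} \<in> S}" "openin X {x \<in> topspace X. R `` {x} \<in> T}" for S T
  proof -
    have "{x \<in> topspace X. R `` {x} \<in> S \<inter> T} =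
          {x \<in> topspace X. R `` {x} \<in> S} \<inter> {x \<in> topspace X. R `` {x} \<in> T}"
      by auto
    then show ?thesis using that by (simp add: openin_Int)
  qed
  moreover have "openin X {x \<in> topspace X. R `` {x} \<in> \<Union>\<K>}"
    if "\<And>K. K \<in> \<K> \<Longrightarrow> openin X {x \<in> topspace X. R `` {x} \<in> K}" for \<K>
  proof -
    have "{x \<in> topspace X. R `` {x} \<in> \<Union>\<K>} = (\<Union>K\<in>\<K>. {x \<in> topspace X. R `` {x} \<in> K})"
      by auto
    then show ?thesis using that by auto
  qed
  ultimately show ?thesis
    unfolding istopology_def by blast
qed

lemma openin_quotient_topology:
  "openin (quotient_topology X R) U \<longleftrightarrow>
     U \<subseteq> topspace X // R \<and> openin X {x \<in> topspace X. R `` {x} \<in> U}"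
  by (simp add: quotient_topology_def topology_inverse'[OF istopology_quotient_topology])

lemma topspace_quotient_topology [simp]: "topspace (quotient_topology X R) = topspace X // R"
proof -
  have "{x \<in> topspace X. R `` {x} \<in> topspace X // R} = topspace X"
    by (auto intro: quotientI)
  then have "openin (quotient_topology X R) (topspace X // R)"
    by (simp add: openin_quotient_topology)
  then show ?thesis
    by (metis openin_quotient_topology openin_subset openin_topspace subset_antisym)
qed

lemma quotient_map_quotient_topology:
  "quotient_map X (quotient_topology X R) (\<lambda>x. R `` {x})"
  unfolding quotient_map_def
  by (auto simp: openin_quotient_topology quotient_def)

(* For an equivalence relation R preserved by f, this sends the class of x to the class of f x. *)
definition induced_map :: "('a \<times> 'a) set \<Rightarrow> ('a \<Rightarrow> 'a) \<Rightarrow> 'a set \<Rightarrow> 'a set" where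
  "induced_map R f C = R `` (f ` C)"

lemma induced_map_class:
  assumes "equiv A R" "\<And>x y. (x, y) \<in> R \<Longrightarrow> (f x, f y) \<in> R" "x \<in> A"
  shows "induced_map R f (R `` {x}) = R `` {f x}"
proof -
  have tr: "trans R" and "(x, x) \<in> R"
    using assms(1,3) by (auto simp: equiv_def refl_on_def)
  then show ?thesis
    unfolding induced_map_def using assms(2) by (blast dest: transD[OF tr])
qed

definition int_iterate :: "'a topology \<Rightarrow> ('a \<Rightarrow> 'a) \<Rightarrow> int \<Rightarrow> 'a \<Rightarrow> 'a" where
  "int_iterate X f n =
     (if n \<ge> 0 then f ^^ nat n else inv_into (topspace X) f ^^ nat (- n))"

(* Intended for compact Hausdorff X: its unique compatible uniformity consists of all
   neighbourhoods of the diagonal. *)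
definition equicontinuous_system :: "'a topology \<Rightarrow> ('a \<Rightarrow> 'a) \<Rightarrow> bool" where
  "equicontinuous_system X f \<longleftrightarrow>
     (\<forall>V. openin (prod_topology X X) V \<and> (\<forall>x\<in>topspace X. (x, x) \<in> V) \<longrightarrow>
       (\<forall>x\<in>topspace X. \<exists>U. openin X U \<and> x \<in> U \<and>
         (\<forall>y\<in>U. \<forall>n. (int_iterate X f n x, int_iterate X f n y) \<in> V)))"

definition minimal_system :: "'a topology \<Rightarrow> ('a \<Rightarrow> 'a) \<Rightarrow> bool" where
  "minimal_system X f \<longleftrightarrow>
     (\<forall>x\<in>topspace X. X closure_of (range (\<lambda>n. int_iterate X f n x)) = topspace X)"

definition conjugate_systems ::
    "'a topology \<Rightarrow> ('a \<Rightarrow> 'a) \<Rightarrow> 'b topology \<Rightarrow> ('b \<Rightarrow> 'b) \<Rightarrow> bool" where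
  "conjugate_systems Y g Y' g' \<longleftrightarrow>
     (\<exists>\<phi>. homeomorphic_map Y Y' \<phi> \<and> (\<forall>y\<in>topspace Y. \<phi> (g y) = g' (\<phi> y)))"

definition closed_invariant_equiv :: "'a topology \<Rightarrow> ('a \<Rightarrow> 'a) \<Rightarrow> ('a \<times> 'a) set \<Rightarrow> bool" where
  "closed_invariant_equiv X f R \<longleftrightarrow>
     equiv (topspace X) R \<and> closedin (prod_topology X X) R \<and>
     (\<forall>x\<in>topspace X. \<forall>y\<in>topspace X. (x, y) \<in> R \<longleftrightarrow> (f x, f y) \<in> R)"

(* LEAST is taken with respect to inclusion; the least element exists when X is compact Hausdorff
   and f is a homeomorphism of X. *)
definition equicontinuous_structure_relation :: "'a topology \<Rightarrow> ('a \<Rightarrow> 'a) \<Rightarrow> ('a \<times> 'a) set" where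
  "equicontinuous_structure_relation X f =
     (LEAST R. closed_invariant_equiv X f R \<and>
               equicontinuous_system (quotient_topology X R) (induced_map R f))"

definition mef_space :: "'a topology \<Rightarrow> ('a \<Rightarrow> 'a) \<Rightarrow> 'a set topology" where
  "mef_space X f = quotient_topology X (equicontinuous_structure_relation X f)"

definition mef_map :: "'a topology \<Rightarrow> ('a \<Rightarrow> 'a) \<Rightarrow> 'a set \<Rightarrow> 'a set" where
  "mef_map X f = induced_map (equicontinuous_structure_relation X f) f"

definition torus_rel :: "((real \<times> real) \<times> (real \<times> real)) set" where
  "torus_rel = {(x, y). fst x - fst y \<in> \<int> \<and> snd x - snd y \<in> \<int>}"

definition torus :: "(real \<times> real) set topology" where
  "torus = quotient_topology euclidean torus_rel"

definition torus_translation :: "real \<times> real \<Rightarrow> (real \<times> real) set \<Rightarrow> (real \<times> real) set" where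
  "torus_translation \<alpha> = induced_map torus_rel (\<lambda>x. x + \<alpha>)"

definition circle_rel :: "(real \<times> real) set" where
  "circle_rel = {(x, y). x - y \<in> \<int>}"

definition circle :: "real set topology" where
  "circle = quotient_topology euclidean circle_rel"

definition circle_rotation :: "real \<Rightarrow> real set \<Rightarrow> real set" where
  "circle_rotation \<alpha> = induced_map circle_rel (\<lambda>x. x + \<alpha>)"

(* 1, a, b are linearly independent over the rationals as a family, so repetitions count as
   dependencies. *)
definition rationally_independent_with_1 :: "real \<Rightarrow> real \<Rightarrow> bool" where
  "rationally_independent_with_1 a b \<longleftrightarrow>
     (\<forall>p q r :: rat. of_rat p + of_rat q * a + of_rat r * b = 0 \<longrightarrow> p = 0 \<and> q = 0 \<and> r = 0)"

end

theory Submission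
  imports Defs
begin

text \<open>
A continuous eigenfunction of a homeomorphism \<open>f\<close> is a function \<open>h\<close> with \<open>h \<circ> f = c h\<close>, where
\<open>c\<close> has modulus one. On a compact Hausdorff space the equicontinuous structure relation identifies
exactly the points on which all continuous eigenfunctions agree
(\<open>equicontinuous_structure_relation_eq\<close>). The maximal equicontinuous factor is therefore known once
the eigenfunctions are.

On the torus a nonvanishing function has a degree in \<open>\<int>\<^sup>2\<close>, and degrees add under multiplication.
An eigenfunction of degree zero has a continuous logarithm \<open>k\<close> on the torus; \<open>k \<circ> f - k\<close> is a
constant, which vanishes because \<open>k\<close> is bounded; so \<open>k\<close> is invariant, and minimality of the factor
makes it constant (\<open>degree_zero_eigenfunction_constant\<close>). Hence eigenfunctions modulo constants
embed into \<open>\<int>\<^sup>2\<close>, and the degrees that occur form a free group of rank zero, one or two. A basis of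
it provides zero, one or two unimodular eigenfunctions of which every other one is a constant times
a monomial. Together they map the factor injectively to a point, the circle or the torus and turn
the induced map into multiplication by the eigenvalues. A multiplicative relation between these
eigenvalues would give an invariant monomial of nonzero degree, which minimality excludes. So the
eigenvalues are independent, and by Kronecker's theorem the image contains a dense orbit and is
everything (\<open>rank_zero\<close>, \<open>rank_one\<close>, \<open>rank_two\<close>).

The analytic input is that eigenfunctions separate the points of every compact Hausdorff
equicontinuous system. It is proved without harmonic analysis on the underlying group
(\<open>equicontinuous_eigenfunctions_separate\<close>): the values of an observable along an orbit form an
almost periodic sequence; a Fourier argument on finite cyclic groups shows that a nonzero sequence
of this kind has, for all large \<open>n\<close>, a trigonometric sum of length \<open>n\<close> whose modulus is at
least a fixed multiple of \<open>n\<close> (\<open>almost_periodic_trigonometric_sum\<close>); and a compactness argument turns the modulated averages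
of the observable into an eigenfunction.
\<close>

section \<open>Large trigonometric sums of almost periodic sequences\<close>

lemma sum_cis_roots_of_unity:
  fixes k :: int
  assumes "N > 0"
  shows "(\<Sum>j<N. cis (2 * pi * real j * of_int k / real N)) = (if int N dvd k then of_nat N else 0)"
proof -
  define w where "w = cis (2 * pi * of_int k / real N)"
  have pow: "cis (2 * pi * real j * of_int k / real N) = w ^ j" for j
    unfolding w_def Complex.DeMoivre by (rule arg_cong[where f = cis]) simp
  have wN: "w ^ N = 1"
    using assms cis_multiple_2pi[of "of_int k"] by (simp add: w_def Complex.DeMoivre)
  show ?thesis
  proof (cases "int N dvd k")
    case True
    then obtain q where "k = int N * q" by (auto elim: dvdE)
    then have "w = 1"
      using assms cis_multiple_2pi[of "of_int q"] by (simp add: w_def mult.assoc)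
    then show ?thesis using True by (simp add: pow)
  next
    case False
    have "w \<noteq> 1"
    proof
      assume "w = 1"
      then have "cos (2 * pi * of_int k / real N) = 1"
        by (simp add: w_def complex_eq_iff)
      then obtain q :: int where "2 * pi * of_int k / real N = of_int q * 2 * pi"
        by (auto simp: cos_one_2pi_int)
      then have "real_of_int k = of_int (q * int N)"
        using assms by (simp add: field_simps)
      then have "k = q * int N" by (simp only: of_int_eq_iff)
      then show False using False by simp
    qed
    then show ?thesis
      using False wN by (simp add: pow sum_gp_strict)
  qed
qed

lemma int_dvd_small_iff:
  fixes k :: int
  assumes "\<bar>k\<bar> < int N"
  shows "int N dvd k \<longleftrightarrow> k = 0"
  using dvd_imp_le_int[of k "int N"] assms by auto

text \<open>Stated for trigonometric sums with arbitrary index sets and frequencies, because it is applied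
below to a product of two such sums, whose terms are indexed by pairs.\<close>

lemma parseval_roots_of_unity:
  fixes x :: "'i \<Rightarrow> complex" and y :: "'k \<Rightarrow> complex" and d :: "'i \<Rightarrow> int" and e :: "'k \<Rightarrow> int"
  assumes "N > 0"
  shows "(\<Sum>j<N. (\<Sum>m\<in>I. x m * cis (2 * pi * real j * of_int (d m) / real N)) *
              cnj (\<Sum>l\<in>J. y l * cis (2 * pi * real j * of_int (e l) / real N)))
       = of_nat N * (\<Sum>m\<in>I. \<Sum>l\<in>J. if int N dvd d m - e l then x m * cnj (y l) else 0)"
proof -
  have cc: "cis (2 * pi * real j * of_int (d m) / real N) * cnj (cis (2 * pi * real j * of_int (e l) / real N))
     = cis (2 * pi * real j * of_int (d m - e l) / real N)" for j m l
    by (simp add: cis_cnj cis_mult diff_divide_distrib algebra_simps)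
  have "(\<Sum>j<N. (\<Sum>m\<in>I. x m * cis (2 * pi * real j * of_int (d m) / real N)) *
              cnj (\<Sum>l\<in>J. y l * cis (2 * pi * real j * of_int (e l) / real N)))
      = (\<Sum>j<N. \<Sum>m\<in>I. \<Sum>l\<in>J. x m * cnj (y l) * cis (2 * pi * real j * of_int (d m - e l) / real N))"
    unfolding cc [symmetric] by (simp add: sum_product cnj_sum mult_ac)
  also have "\<dots> = (\<Sum>m\<in>I. \<Sum>l\<in>J. x m * cnj (y l) * (\<Sum>j<N. cis (2 * pi * real j * of_int (d m - e l) / real N)))"
    by (subst sum.swap, rule sum.cong[OF refl], subst sum.swap) (simp add: sum_distrib_left)
  also have "\<dots> = of_nat N * (\<Sum>m\<in>I. \<Sum>l\<in>J. if int N dvd d m - e l then x m * cnj (y l) else 0)"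
    unfolding sum_cis_roots_of_unity[OF assms]
    by (simp add: sum_distrib_left if_distrib mult_ac cong: if_cong)
  finally show ?thesis .
qed

text \<open>Write \<open>A\<close> for the trigonometric sum of \<open>a\<close> and \<open>B\<close> for that of the indicator of the set
\<open>P\<close> of time shifts. The mean of \<open>|A|\<^sup>2 cnj B\<close> over roots of unity adds up the autocorrelations
of \<open>a\<close> at the shifts in \<open>P\<close>. It is at most \<open>max |A|\<close> times the mean of \<open>|A| |B|\<close>, which
Cauchy-Schwarz and Parseval control. So large autocorrelations at many shifts force \<open>A\<close> to be
large at a single frequency.\<close>

lemma large_trigonometric_sum:
  fixes a :: "nat \<Rightarrow> real"
  assumes "n > 0" and "finite P" and P: "\<And>p. p \<in> P \<Longrightarrow> p < n"
    and corr: "\<And>p. p \<in> P \<Longrightarrow> r \<le> (\<Sum>l<n - p. a (l + p) * a l)"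
    and small: "\<And>z::complex. norm z = 1 \<Longrightarrow> norm (\<Sum>m<n. of_real (a m) * z ^ m) \<le> C"
  shows "real (card P) * r \<le> C * (L2_set a {..<n} * sqrt (real (card P)))"
proof -
  \<comment> \<open>The frequencies met below differ by less than \<open>2 * n\<close>, so none of them alias.\<close>
  define N where "N = 2 * n"
  have N: "N > 0" using assms by (simp add: N_def)
  define A where "A j = (\<Sum>m<n. of_real (a m) * cis (2 * pi * real j * of_int (int m) / real N))" for j
  define B where "B j = (\<Sum>p\<in>P. 1 * cis (2 * pi * real j * of_int (int p) / real N))" for j
  have AA: "(\<Sum>j<N. (norm (A j))\<^sup>2) = real N * (\<Sum>m<n. (a m)\<^sup>2)"
  proof -
    have "complex_of_real (\<Sum>j<N. (norm (A j))\<^sup>2) = (\<Sum>j<N. A j * cnj (A j))"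
      unfolding of_real_sum complex_norm_square ..
    also have "\<dots> = of_nat N * (\<Sum>m<n. \<Sum>l<n. if int N dvd int m - int l then of_real (a m) * cnj (of_real (a l)) else 0)"
      unfolding A_def by (rule parseval_roots_of_unity[OF N])
    also have "(\<Sum>m<n. \<Sum>l<n. if int N dvd int m - int l then of_real (a m) * cnj (complex_of_real (a l)) else 0)
        = (\<Sum>m<n. \<Sum>l<n. if l = m then of_real (a m) * of_real (a m) else 0)"
    proof (intro sum.cong refl)
      fix m l assume "m \<in> {..<n}" "l \<in> {..<n}"
      then have "int N dvd int m - int l \<longleftrightarrow> l = m"
        using int_dvd_small_iff[where N = N and k = "int m - int l"] by (simp add: N_def) linarith
      then show "(if int N dvd int m - int l then of_real (a m) * cnj (complex_of_real (a l)) else 0) =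
          (if l = m then of_real (a m) * of_real (a m) else 0)" by auto
    qed
    also have "\<dots> = of_real (\<Sum>m<n. (a m)\<^sup>2)"
      by (simp add: power2_eq_square)
    finally have "complex_of_real (\<Sum>j<N. (norm (A j))\<^sup>2) = of_real (real N * (\<Sum>m<n. (a m)\<^sup>2))"
      by simp
    then show ?thesis by (simp only: of_real_eq_iff)
  qed
  have BB: "(\<Sum>j<N. (norm (B j))\<^sup>2) = real N * real (card P)"
  proof -
    have "complex_of_real (\<Sum>j<N. (norm (B j))\<^sup>2) = (\<Sum>j<N. B j * cnj (B j))"
      unfolding of_real_sum complex_norm_square ..
    also have "\<dots> = of_nat N * (\<Sum>m\<in>P. \<Sum>l\<in>P. if int N dvd int m - int l then 1 * cnj 1 else 0)"
      unfolding B_def by (rule parseval_roots_of_unity[OF N])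
    also have "(\<Sum>m\<in>P. \<Sum>l\<in>P. if int N dvd int m - int l then 1 * cnj (1::complex) else 0)
        = (\<Sum>m\<in>P. \<Sum>l\<in>P. if l = m then 1 else 0)"
    proof (intro sum.cong refl)
      fix m l assume "m \<in> P" "l \<in> P"
      then have "m < n" "l < n" using P by auto
      then have "int N dvd int m - int l \<longleftrightarrow> l = m"
        using int_dvd_small_iff[where N = N and k = "int m - int l"] by (simp add: N_def) linarith
      then show "(if int N dvd int m - int l then 1 * cnj (1::complex) else 0) =
          (if l = m then 1 else 0)" by auto
    qed
    also have "\<dots> = of_real (real (card P))"
      using \<open>finite P\<close> by simp
    finally have "complex_of_real (\<Sum>j<N. (norm (B j))\<^sup>2) = of_real (real N * real (card P))"
      by simp
    then show ?thesis by (simp only: of_real_eq_iff)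
  qed
  have AB: "(\<Sum>j<N. A j * cnj (A j * B j)) = of_real (real N * (\<Sum>p\<in>P. \<Sum>l<n - p. a (l + p) * a l))"
  proof -
    have cc: "cis (2 * pi * real j * of_int (int m) / real N) * cis (2 * pi * real j * of_int (int p) / real N)
        = cis (2 * pi * real j * of_int (int m + int p) / real N)" for j m p
      unfolding cis_mult by (simp only: of_int_add distrib_left add_divide_distrib)
    have prod: "A j * B j = (\<Sum>q\<in>{..<n} \<times> P. (of_real (a (fst q))) *
              cis (2 * pi * real j * of_int (int (fst q) + int (snd q)) / real N))" for j
    proof -
      have r: "(x * c) * (1 * d) = x * (c * d)" for x c d :: complex
        by simp
      have "A j * B j = (\<Sum>m<n. \<Sum>p\<in>P. of_real (a m) *
              cis (2 * pi * real j * of_int (int m + int p) / real N))"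
        unfolding A_def B_def sum_product by (simp only: r cc)
      also have "\<dots> = (\<Sum>q\<in>{..<n} \<times> P. of_real (a (fst q)) *
              cis (2 * pi * real j * of_int (int (fst q) + int (snd q)) / real N))"
        unfolding sum.cartesian_product by (simp only: case_prod_unfold)
      finally show ?thesis .
    qed
    have "(\<Sum>j<N. A j * cnj (A j * B j)) = of_nat N * (\<Sum>m<n. \<Sum>q\<in>{..<n} \<times> P.
       if int N dvd int m - (int (fst q) + int (snd q)) then of_real (a m) * cnj (of_real (a (fst q))) else 0)"
      unfolding prod unfolding A_def by (rule parseval_roots_of_unity[OF N])
    also have "(\<Sum>m<n. \<Sum>q\<in>{..<n} \<times> P.
       if int N dvd int m - (int (fst q) + int (snd q)) then of_real (a m) * cnj (complex_of_real (a (fst q))) else 0)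
      = (\<Sum>q\<in>{..<n} \<times> P. \<Sum>m<n. if m = fst q + snd q then of_real (a m * a (fst q)) else 0)"
    proof (subst sum.swap, intro sum.cong refl)
      fix m q assume m: "m \<in> {..<n}" and q: "q \<in> {..<n} \<times> P"
      obtain l p where lp: "q = (l, p)" by (cases q)
      have "l < n" "p < n" "m < n" using m q P by (auto simp: lp)
      then have "int N dvd int m - (int l + int p) \<longleftrightarrow> m = l + p"
        using int_dvd_small_iff[where N = N and k = "int m - (int l + int p)"] by (simp add: N_def) linarith
      then show "(if int N dvd int m - (int (fst q) + int (snd q)) then of_real (a m) * cnj (complex_of_real (a (fst q))) else 0)
        = (if m = fst q + snd q then of_real (a m * a (fst q)) else 0)" by (auto simp: lp)
    qed
    also have "\<dots> = (\<Sum>q\<in>{..<n} \<times> P. if fst q + snd q < n then of_real (a (fst q + snd q) * a (fst q)) else 0)"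
      by (intro sum.cong) auto
    also have "\<dots> = (\<Sum>p\<in>P. \<Sum>l<n. if l + p < n then complex_of_real (a (l + p) * a l) else 0)"
      by (subst sum.swap) (simp add: sum.cartesian_product case_prod_unfold)
    also have "\<dots> = (\<Sum>p\<in>P. \<Sum>l<n - p. complex_of_real (a (l + p) * a l))"
    proof (rule sum.cong[OF refl])
      fix p
      have "{..<n - p} = {l \<in> {..<n}. l + p < n}" by auto
      then show "(\<Sum>l<n. if l + p < n then complex_of_real (a (l + p) * a l) else 0) =
          (\<Sum>l<n - p. complex_of_real (a (l + p) * a l))"
        by (simp only: sum.inter_filter finite_lessThan)
    qed
    finally show ?thesis by simp
  qed
  have Abound: "norm (A j) \<le> C" for j
  proof -
    have "A j = (\<Sum>m<n. of_real (a m) * cis (2 * pi * real j / real N) ^ m)"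
      unfolding A_def Complex.DeMoivre by (simp add: mult_ac)
    then show ?thesis using small by simp
  qed
  have C0: "C \<ge> 0" using order_trans[OF norm_ge_zero Abound] .
  have "real N * (real (card P) * r) \<le> real N * (\<Sum>p\<in>P. \<Sum>l<n - p. a (l + p) * a l)"
    using sum_mono[of P "\<lambda>_. r", OF corr] by (intro mult_left_mono) simp_all
  also have "\<dots> \<le> norm (\<Sum>j<N. A j * cnj (A j * B j))"
    unfolding AB norm_of_real by (rule abs_ge_self)
  also have "\<dots> \<le> (\<Sum>j<N. norm (A j * cnj (A j * B j)))"
    by (rule norm_sum)
  also have "\<dots> \<le> (\<Sum>j<N. C * (norm (A j) * norm (B j)))"
    using Abound by (intro sum_mono) (simp add: norm_mult mult_right_mono)
  also have "\<dots> = C * (\<Sum>j<N. \<bar>norm (A j)\<bar> * \<bar>norm (B j)\<bar>)"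
    by (simp add: sum_distrib_left)
  also have "\<dots> \<le> C * (L2_set (\<lambda>j. norm (A j)) {..<N} * L2_set (\<lambda>j. norm (B j)) {..<N})"
    by (intro mult_left_mono L2_set_mult_ineq C0)
  also have "\<dots> = real N * (C * (L2_set a {..<n} * sqrt (real (card P))))"
    unfolding L2_set_def AA BB by (simp add: real_sqrt_mult)
  finally show ?thesis using N by simp
qed

text \<open>The hypothesis says that for each \<open>e\<close> the \<open>e\<close>-almost periods of \<open>a\<close> have positive lower
density. Those below a small fraction of \<open>n\<close> are the shifts to which
\<open>large_trigonometric_sum\<close> is applied: at such a shift the autocorrelation is nearly the full
mean square of \<open>a\<close>, and this is bounded below because \<open>a\<close> keeps returning near its nonzero
initial value. The frequency depends on \<open>n\<close>; the constant \<open>c\<close> does not, and that is what lets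
a limit of normalised sums be nonzero.\<close>

lemma almost_periodic_trigonometric_sum:
  fixes a :: "nat \<Rightarrow> real"
  assumes a0: "a 0 \<noteq> 0" and bdd: "\<And>m. \<bar>a m\<bar> \<le> B"
    and ap: "\<And>e. e > 0 \<Longrightarrow> \<exists>K>0. \<forall>M. real M \<le> K * real (card {p. p < M \<and> (\<forall>m. \<bar>a (m + p) - a m\<bar> \<le> e)})"
  obtains c n0 where "c > 0"
    "\<And>n. n \<ge> n0 \<Longrightarrow> \<exists>z::complex. norm z = 1 \<and> c * real n \<le> norm (\<Sum>m<n. of_real (a m) * z ^ m)"
proof -
  have B: "B > 0" using a0 bdd[of 0] by linarith
  obtain K1 where K1: "K1 > 0"
    "\<And>M. real M \<le> K1 * real (card {p. p < M \<and> (\<forall>m. \<bar>a (m + p) - a m\<bar> \<le> \<bar>a 0\<bar> / 2)})"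
    using ap[of "\<bar>a 0\<bar> / 2"] a0 by auto
  \<comment> \<open>Near returns to \<open>a 0\<close> alone give \<open>a\<close> a mean square of at least \<open>s\<close>.\<close>
  define s where "s = (\<bar>a 0\<bar> / 2)\<^sup>2 / K1"
  have s: "s > 0" using a0 K1 by (simp add: s_def)
  have sq: "s * real n \<le> (\<Sum>m<n. (a m)\<^sup>2)" for n
  proof -
    let ?P = "{p. p < n \<and> (\<forall>m. \<bar>a (m + p) - a m\<bar> \<le> \<bar>a 0\<bar> / 2)}"
    have "s * real n \<le> s * (K1 * real (card ?P))"
      using K1(2)[of n] s by (intro mult_left_mono) auto
    also have "\<dots> = (\<Sum>p\<in>?P. (\<bar>a 0\<bar> / 2)\<^sup>2)"
      using K1 by (simp add: s_def)
    also have "\<dots> \<le> (\<Sum>p\<in>?P. (a p)\<^sup>2)"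
    proof (intro sum_mono)
      fix p assume "p \<in> ?P"
      then have "\<bar>a p - a 0\<bar> \<le> \<bar>a 0\<bar> / 2" by (metis (no_types, lifting) add_0 mem_Collect_eq)
      then have "\<bar>a 0\<bar> / 2 \<le> \<bar>a p\<bar>" by linarith
      then show "(\<bar>a 0\<bar> / 2)\<^sup>2 \<le> (a p)\<^sup>2"
        by (metis abs_ge_zero divide_nonneg_nonneg power2_abs power_mono zero_le_numeral)
    qed
    also have "\<dots> \<le> (\<Sum>m<n. (a m)\<^sup>2)"
      by (intro sum_mono2) auto
    finally show ?thesis .
  qed
  have sB: "s \<le> B\<^sup>2"
    using sq[of 1] power_mono[OF bdd[of 0], of 2] by simp
  \<comment> \<open>The tolerance \<open>e\<close> of an almost period and the restriction to shifts below \<open>d * n\<close> each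
     cost at most \<open>s / 4\<close> per term, which leaves half of the mean square.\<close>
  define e where "e = s / (4 * B)"
  have e: "e > 0" using s B by (simp add: e_def)
  obtain K where K: "K > 0"
    "\<And>M. real M \<le> K * real (card {p. p < M \<and> (\<forall>m. \<bar>a (m + p) - a m\<bar> \<le> e)})"
    using ap[OF e] by auto
  define d where "d = s / (4 * B\<^sup>2)"
  have d: "d > 0" "d < 1" using s B sB by (auto simp: d_def divide_simps)
  define c where "c = s / (2 * B) * sqrt (d / (2 * K)) / 2"
  have c: "c > 0" using s B d K by (simp add: c_def)
  define n0 where "n0 = nat \<lceil>1 / d\<rceil>"
  have main: "\<exists>z::complex. norm z = 1 \<and> c * real n \<le> norm (\<Sum>m<n. of_real (a m) * z ^ m)" if n: "n \<ge> n0" for n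
  proof (rule ccontr)
    assume "\<not> ?thesis"
    then have small: "norm (\<Sum>m<n. of_real (a m) * z ^ m) \<le> c * real n" if "norm z = 1" for z :: complex
      using that by (meson linear)
    have nd: "real n * d \<ge> 1"
      using n d unfolding n0_def nat_ceiling_le_eq by (simp add: field_simps)
    have npos: "n > 0" using nd by (cases n) auto
    define M where "M = nat \<lfloor>real n * d\<rfloor>"
    have M: "real M \<le> real n * d" "real n * d \<le> 2 * real M" "M > 0"
    proof -
      have "1 \<le> \<lfloor>real n * d\<rfloor>" using nd by (simp add: le_floor_iff)
      then show "real M \<le> real n * d" "real n * d \<le> 2 * real M" "M > 0"
        unfolding M_def by linarith+
    qed
    have "real M \<le> real n" using M(1) d by (smt (verit) mult_left_le of_nat_0_le_iff)
    then have Mn: "M \<le> n" by simp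
    define P where "P = {p. p < M \<and> (\<forall>m. \<bar>a (m + p) - a m\<bar> \<le> e)}"
    have P: "p < n" if "p \<in> P" for p using that Mn by (auto simp: P_def)
    have cP: "real M \<le> K * real (card P)" using K(2) by (simp add: P_def)
    have finP: "finite P" unfolding P_def by simp
    have corr: "s / 2 * real n \<le> (\<Sum>l<n - p. a (l + p) * a l)" if p: "p \<in> P" for p
    proof -
      have pM: "p < M" "\<And>m. \<bar>a (m + p) - a m\<bar> \<le> e" using p by (auto simp: P_def)
      have "(\<Sum>m<n. (a m)\<^sup>2) = (\<Sum>m<n - p. (a m)\<^sup>2) + (\<Sum>m\<in>{n - p..<n}. (a m)\<^sup>2)"
        by (metis (no_types, lifting) diff_le_self le0 lessThan_atLeast0 sum.atLeastLessThan_concat)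
      also have "(\<Sum>m\<in>{n - p..<n}. (a m)\<^sup>2) \<le> (\<Sum>m\<in>{n - p..<n}. B\<^sup>2)"
        using bdd by (intro sum_mono) (metis abs_ge_zero power2_abs power_mono)
      also have "\<dots> \<le> real M * B\<^sup>2"
        using pM by (auto intro!: mult_right_mono)
      also have "\<dots> \<le> real n * d * B\<^sup>2" using M by (intro mult_right_mono) auto
      also have "\<dots> = s / 4 * real n" using B by (simp add: d_def field_simps)
      finally have 1: "(\<Sum>m<n. (a m)\<^sup>2) - s / 4 * real n \<le> (\<Sum>m<n - p. (a m)\<^sup>2)" by simp
      have "(a l)\<^sup>2 - a (l + p) * a l \<le> s / 4" for l
      proof -
        have "(a l)\<^sup>2 - a (l + p) * a l = - ((a (l + p) - a l) * a l)"
          by (simp add: power2_eq_square algebra_simps)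
        also have "\<dots> \<le> \<bar>a (l + p) - a l\<bar> * \<bar>a l\<bar>"
          by (metis abs_ge_minus_self abs_mult)
        also have "\<dots> \<le> e * B" using pM(2) bdd e by (intro mult_mono) auto
        also have "\<dots> = s / 4" using B by (simp add: e_def)
        finally show ?thesis .
      qed
      then have "(\<Sum>l<n - p. (a l)\<^sup>2 - a (l + p) * a l) \<le> (\<Sum>l<n - p. s / 4)"
        by (intro sum_mono)
      also have "\<dots> \<le> s / 4 * real n" using s by simp
      finally have "(\<Sum>l<n - p. (a l)\<^sup>2) - s / 4 * real n \<le> (\<Sum>l<n - p. a (l + p) * a l)"
        by (simp add: sum_subtractf)
      then show ?thesis using 1 sq[of n] by (simp add: field_simps)
    qed
    have cPpos: "real (card P) > 0"
      using cP M(3) K by (smt (verit) mult_nonneg_nonpos of_nat_0_less_iff)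
    have L2: "L2_set a {..<n} \<le> B * sqrt (real n)"
    proof -
      have "(\<Sum>m<n. (a m)\<^sup>2) \<le> (\<Sum>m<n. B\<^sup>2)"
        using bdd by (intro sum_mono) (metis abs_ge_zero power2_abs power_mono)
      then have "sqrt (\<Sum>m<n. (a m)\<^sup>2) \<le> sqrt (real n * B\<^sup>2)" by simp
      then show ?thesis using B by (simp add: L2_set_def real_sqrt_mult mult.commute)
    qed
    have "real (card P) * (s / 2 * real n) \<le> c * real n * (L2_set a {..<n} * sqrt (real (card P)))"
      using large_trigonometric_sum[OF npos finP P corr small] .
    also have "\<dots> \<le> c * real n * (B * sqrt (real n) * sqrt (real (card P)))"
      using c L2 by (intro mult_left_mono mult_right_mono) auto
    finally have "sqrt (real (card P)) * (sqrt (real (card P)) * (s / 2) * real n)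
      \<le> sqrt (real (card P)) * (c * B * sqrt (real n) * real n)"
      by (simp add: algebra_simps)
    then have 2: "sqrt (real (card P)) * (s / 2) \<le> c * B * sqrt (real n)"
      using cPpos npos by (simp del: of_nat_0_less_iff)
    have "d / (2 * K) * real n \<le> real (card P)"
      using cP M(2) K by (simp add: field_simps)
    then have "sqrt (d / (2 * K)) * sqrt (real n) \<le> sqrt (real (card P))"
      by (metis real_sqrt_le_iff real_sqrt_mult)
    then have "sqrt (d / (2 * K)) * sqrt (real n) * (s / 2) \<le> c * B * sqrt (real n)"
      using 2 s by (smt (verit) half_gt_zero mult_right_mono)
    then have "sqrt (d / (2 * K)) * (s / 2) \<le> c * B"
      using npos by (simp add: mult.assoc mult.left_commute[of _ "sqrt (real n)"] mult.commute[of _ "sqrt (real n)"])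
    also have "\<dots> = sqrt (d / (2 * K)) * (s / 2) / 2"
      using B by (simp add: c_def)
    finally show False using s d K by (simp add: mult_le_0_iff)
  qed
  show ?thesis by (rule that[OF c main])
qed

section \<open>Eigenfunctions of equicontinuous systems\<close>

definition eigenfunction :: "'a topology \<Rightarrow> ('a \<Rightarrow> 'a) \<Rightarrow> complex \<Rightarrow> ('a \<Rightarrow> complex) \<Rightarrow> bool" where
  "eigenfunction X f c h \<longleftrightarrow>
     continuous_map X euclidean h \<and> norm c = 1 \<and> (\<forall>x\<in>topspace X. h (f x) = c * h x)"

lemma int_iterate_of_nat [simp]: "int_iterate X f (int n) = f ^^ n"
  by (simp add: int_iterate_def)

lemma int_iterate_zero [simp]: "int_iterate X f 0 = id"
  by (simp add: int_iterate_def id_def)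

lemma int_iterate_in_topspace:
  assumes "bij_betw f (topspace X) (topspace X)" "x \<in> topspace X"
  shows "int_iterate X f n x \<in> topspace X"
proof -
  have 1: "(f ^^ k) x \<in> topspace X" for k
    using assms by (induction k) (auto simp: bij_betw_def)
  have 2: "(inv_into (topspace X) f ^^ k) x \<in> topspace X" for k
    using assms by (induction k) (auto simp: bij_betw_def inv_into_into)
  show ?thesis using 1 2 by (simp add: int_iterate_def)
qed

lemma int_iterate_add_one:
  assumes "bij_betw f (topspace X) (topspace X)" "x \<in> topspace X"
  shows "int_iterate X f (n + 1) x = f (int_iterate X f n x)"
proof (cases "n \<ge> 0")
  case True
  then have "nat (n + 1) = Suc (nat n)" by simp
  then show ?thesis using True by (simp add: int_iterate_def)
next
  case False
  then obtain k where k: "n = - int (Suc k)"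
    by (metis int_cases not_le of_nat_0_le_iff)
  let ?y = "(inv_into (topspace X) f ^^ k) x"
  have y: "?y \<in> topspace X"
    using int_iterate_in_topspace[OF assms, of "- int k"] by (cases "k = 0") (auto simp: int_iterate_def assms)
  have "int_iterate X f (n + 1) x = ?y"
    by (cases k) (auto simp: k int_iterate_def nat_add_distrib)
  moreover have "f (int_iterate X f n x) = ?y"
    using assms(1) y f_inv_into_f[of ?y f "topspace X"]
    by (simp add: k int_iterate_def bij_betw_def nat_add_distrib)
  ultimately show ?thesis by simp
qed

lemma int_iterate_add:
  assumes "bij_betw f (topspace X) (topspace X)" "x \<in> topspace X"
  shows "int_iterate X f (m + n) x = int_iterate X f m (int_iterate X f n x)"
proof (induction m rule: int_induct[of _ 0])
  case base
  show ?case by simp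
next
  case (step1 i)
  have "int_iterate X f (i + 1 + n) x = f (int_iterate X f (i + n) x)"
    using int_iterate_add_one[OF assms, of "i + n"] by (simp add: algebra_simps)
  then show ?case
    using step1 int_iterate_add_one[OF assms(1) int_iterate_in_topspace[OF assms], of i n] by simp
next
  case (step2 i)
  have "f (int_iterate X f (i - 1 + n) x) = int_iterate X f (i + n) x"
    using int_iterate_add_one[OF assms, of "i - 1 + n"] by (simp add: algebra_simps)
  also have "\<dots> = f (int_iterate X f (i - 1) (int_iterate X f n x))"
    using step2 int_iterate_add_one[OF assms(1) int_iterate_in_topspace[OF assms], of "i - 1" n] by simp
  finally show ?case
    using assms by (auto simp: bij_betw_def inj_on_def int_iterate_in_topspace)
qed

lemma equicontinuous_system_observable:
  fixes \<phi> :: "'a \<Rightarrow> real"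
  assumes eq: "equicontinuous_system Y g" and cont: "continuous_map Y euclideanreal \<phi>"
    and "e > 0" "y \<in> topspace Y"
  obtains U where "openin Y U" "y \<in> U"
    "\<And>z n. z \<in> U \<Longrightarrow> \<bar>\<phi> (int_iterate Y g n y) - \<phi> (int_iterate Y g n z)\<bar> < e"
proof -
  define V where "V = {p \<in> topspace (prod_topology Y Y). \<bar>\<phi> (fst p) - \<phi> (snd p)\<bar> \<in> {..<e}}"
  have "continuous_map (prod_topology Y Y) euclideanreal (\<lambda>p. \<bar>\<phi> (fst p) - \<phi> (snd p)\<bar>)"
    by (intro continuous_intros continuous_map_compose[OF continuous_map_fst cont, unfolded o_def]
        continuous_map_compose[OF continuous_map_snd cont, unfolded o_def])
  then have "openin (prod_topology Y Y) V"
    unfolding V_def by (rule openin_continuous_map_preimage) auto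
  moreover have "\<forall>x\<in>topspace Y. (x, x) \<in> V"
    using \<open>e > 0\<close> by (simp add: V_def)
  ultimately obtain U where U: "openin Y U" "y \<in> U"
    "\<forall>z\<in>U. \<forall>n. (int_iterate Y g n y, int_iterate Y g n z) \<in> V"
    using eq \<open>y \<in> topspace Y\<close> unfolding equicontinuous_system_def by meson
  show ?thesis
    by (rule that[OF U(1,2)]) (use U(3) in \<open>auto simp: V_def\<close>)
qed

lemma equicontinuous_finite_partition:
  fixes \<phi> :: "'a \<Rightarrow> real"
  assumes eq: "equicontinuous_system Y g" and cont: "continuous_map Y euclideanreal \<phi>"
    and "compact_space Y" "e > 0"
  obtains F and col :: "'a \<Rightarrow> 'a" where "finite F" "\<And>y. y \<in> topspace Y \<Longrightarrow> col y \<in> F"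
    "\<And>y z n. \<lbrakk>y \<in> topspace Y; z \<in> topspace Y; col y = col z\<rbrakk> \<Longrightarrow>
      \<bar>\<phi> (int_iterate Y g n y) - \<phi> (int_iterate Y g n z)\<bar> < e"
proof -
  have "\<forall>x\<in>topspace Y. \<exists>U. openin Y U \<and> x \<in> U \<and>
     (\<forall>z\<in>U. \<forall>n. \<bar>\<phi> (int_iterate Y g n x) - \<phi> (int_iterate Y g n z)\<bar> < e / 2)"
  proof
    fix x assume "x \<in> topspace Y"
    from equicontinuous_system_observable[OF eq cont half_gt_zero[OF \<open>e > 0\<close>] this]
    show "\<exists>U. openin Y U \<and> x \<in> U \<and>
      (\<forall>z\<in>U. \<forall>n. \<bar>\<phi> (int_iterate Y g n x) - \<phi> (int_iterate Y g n z)\<bar> < e / 2)"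
      by metis
  qed
  then obtain U where U: "\<And>x. x \<in> topspace Y \<Longrightarrow> openin Y (U x) \<and> x \<in> U x \<and>
     (\<forall>z\<in>U x. \<forall>n. \<bar>\<phi> (int_iterate Y g n x) - \<phi> (int_iterate Y g n z)\<bar> < e / 2)"
    by metis
  have "\<exists>\<F>. finite \<F> \<and> \<F> \<subseteq> U ` topspace Y \<and> topspace Y \<subseteq> \<Union>\<F>"
  proof -
    have "Ball (U ` topspace Y) (openin Y)" "topspace Y \<subseteq> \<Union>(U ` topspace Y)"
      using U by auto
    then show ?thesis
      using \<open>compact_space Y\<close> unfolding compact_space_alt by meson
  qed
  then obtain F where F: "finite F" "F \<subseteq> topspace Y" "topspace Y \<subseteq> \<Union>(U ` F)"
    by (metis finite_subset_image)
  then have "\<forall>y\<in>topspace Y. \<exists>x. x \<in> F \<and> y \<in> U x" by auto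
  then obtain col where col: "\<And>y. y \<in> topspace Y \<Longrightarrow> col y \<in> F \<and> y \<in> U (col y)"
    by metis
  show ?thesis
  proof (rule that)
    fix y z n assume yz: "y \<in> topspace Y" "z \<in> topspace Y" "col y = col z"
    then have "col y \<in> topspace Y" "y \<in> U (col y)" "z \<in> U (col y)"
      using col F(2) by (fastforce, fastforce, metis)
    then have "\<bar>\<phi> (int_iterate Y g n (col y)) - \<phi> (int_iterate Y g n y)\<bar> < e / 2"
      "\<bar>\<phi> (int_iterate Y g n (col y)) - \<phi> (int_iterate Y g n z)\<bar> < e / 2"
      using U by blast+
    then show "\<bar>\<phi> (int_iterate Y g n y) - \<phi> (int_iterate Y g n z)\<bar> < e" by linarith
  qed (use F(1) col in auto)
qed

text \<open>Two orbit points with the same colour in a fine partition stay close under all iterates, in both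
directions of time, so the difference of their times is an almost period for every starting time.
Among the first \<open>M\<close> times one pair of colours occurs for a fixed proportion, and subtracting the
first of these times from the others yields as many almost periods below \<open>M\<close>.\<close>

lemma equicontinuous_almost_periodic:
  fixes \<phi> :: "'a \<Rightarrow> real"
  assumes eq: "equicontinuous_system Y g" and cont: "continuous_map Y euclideanreal \<phi>"
    and comp: "compact_space Y" and bij: "bij_betw g (topspace Y) (topspace Y)"
    and y: "y \<in> topspace Y" "y' \<in> topspace Y" and "e > 0"
  defines "a \<equiv> \<lambda>n. \<phi> ((g ^^ n) y) - \<phi> ((g ^^ n) y')"
  shows "\<exists>K>0. \<forall>M. real M \<le> K * real (card {p. p < M \<and> (\<forall>m. \<bar>a (m + p) - a m\<bar> \<le> e)})"
proof -
  obtain F and col :: "'a \<Rightarrow> 'a" where F: "finite F" "\<And>y. y \<in> topspace Y \<Longrightarrow> col y \<in> F"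
    and col: "\<And>y z n. \<lbrakk>y \<in> topspace Y; z \<in> topspace Y; col y = col z\<rbrakk> \<Longrightarrow>
      \<bar>\<phi> (int_iterate Y g n y) - \<phi> (int_iterate Y g n z)\<bar> < e / 2"
    using equicontinuous_finite_partition[OF eq cont comp half_gt_zero[OF \<open>e > 0\<close>]] by metis
  let ?T = "int_iterate Y g"
  define cc where "cc k = (col (?T (int k) y), col (?T (int k) y'))" for k
  have cc: "cc k \<in> F \<times> F" for k
    using F(2) int_iterate_in_topspace[OF bij] y by (auto simp: cc_def simp del: int_iterate_of_nat)
  have close: "\<bar>a (m + (l - k)) - a m\<bar> \<le> e" if kl: "k \<le> l" "cc k = cc l" for k l m
  proof -
    have *: "\<bar>\<phi> ((g ^^ m) z) - \<phi> ((g ^^ (m + (l - k))) z)\<bar> < e / 2"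
      if z: "z \<in> topspace Y" and c: "col (?T (int k) z) = col (?T (int l) z)" for z
    proof -
      have shift: "?T (int m - int k) (?T (int k) z) = ?T (int m) z"
        "?T (int m - int k) (?T (int l) z) = ?T (int (m + (l - k))) z"
        using kl(1) by (simp_all add: int_iterate_add[OF bij z, symmetric] algebra_simps
            del: int_iterate_of_nat)
      show ?thesis
        using col[OF int_iterate_in_topspace[OF bij z] int_iterate_in_topspace[OF bij z] c, of "int m - int k"]
        unfolding shift unfolding int_iterate_of_nat .
    qed
    have "col (?T (int k) y) = col (?T (int l) y)" "col (?T (int k) y') = col (?T (int l) y')"
      using kl(2) by (auto simp: cc_def)
    from *[OF y(1) this(1)] *[OF y(2) this(2)] show ?thesis
      unfolding a_def by linarith
  qed
  define K where "K = real (card (F \<times> F))"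
  have "K > 0"
    using cc F(1) unfolding K_def by (metis card_gt_0_iff empty_iff finite_cartesian_product of_nat_0_less_iff)
  moreover have "real M \<le> K * real (card {p. p < M \<and> (\<forall>m. \<bar>a (m + p) - a m\<bar> \<le> e)})" for M
  proof (cases "M = 0")
    case False
    have "\<exists>c\<in>F \<times> F. card {..<M} \<le> card (cc -` {c} \<inter> {..<M}) * card (F \<times> F)"
      using F(1) cc by (intro pigeonhole_card funcsetI finite_cartesian_product finite_lessThan) blast+
    moreover have "cc -` {c} \<inter> {..<M} = {k. k < M \<and> cc k = c}" for c
      by auto
    ultimately obtain c where c: "M \<le> card (F \<times> F) * card {k. k < M \<and> cc k = c}"
      by (auto simp: mult.commute)
    let ?S = "{k. k < M \<and> cc k = c}"
    have "?S \<noteq> {}" using c False by (metis card.empty le_zero_eq mult_0_right)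
    define k0 where "k0 = Min ?S"
    have fin: "finite ?S" by simp
    have k0: "k0 \<in> ?S" "\<And>k. k \<in> ?S \<Longrightarrow> k0 \<le> k"
      using Min_in[OF fin \<open>?S \<noteq> {}\<close>] Min_le[OF fin] by (auto simp: k0_def)
    have "card ?S \<le> card {p. p < M \<and> (\<forall>m. \<bar>a (m + p) - a m\<bar> \<le> e)}"
    proof (rule card_inj_on_le[of "\<lambda>k. k - k0"])
      show "inj_on (\<lambda>k. k - k0) ?S"
        using k0(2) by (intro inj_onI) (metis le_add_diff_inverse2)
      show "(\<lambda>k. k - k0) ` ?S \<subseteq> {p. p < M \<and> (\<forall>m. \<bar>a (m + p) - a m\<bar> \<le> e)}"
      proof safe
        fix k assume "k < M" "c = cc k"
        then have "k0 \<le> k" "cc k0 = cc k" using k0 by auto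
        then show "k - k0 < M" "\<And>m. \<bar>a (m + (k - k0)) - a m\<bar> \<le> e"
          using close \<open>k < M\<close> by auto
      qed
    qed simp
    then have "M \<le> card (F \<times> F) * card {p. p < M \<and> (\<forall>m. \<bar>a (m + p) - a m\<bar> \<le> e)}"
      using c by (meson mult_le_mono2 order_trans)
    then show ?thesis
      unfolding K_def by (simp only: of_nat_le_iff flip: of_nat_mult)
  qed simp
  ultimately show ?thesis by blast
qed


lemma continuous_map_into_metric:
  fixes h :: "'a \<Rightarrow> 'b::metric_space"
  assumes "\<And>x e. \<lbrakk>x \<in> topspace X; e > 0\<rbrakk> \<Longrightarrow> \<exists>U. openin X U \<and> x \<in> U \<and> (\<forall>y\<in>U. dist (h x) (h y) < e)"
  shows "continuous_map X euclidean h"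
  unfolding continuous_map_def
proof (intro conjI allI impI)
  fix V :: "'b set" assume "openin euclidean V"
  then have V: "open V" by simp
  show "openin X {x \<in> topspace X. h x \<in> V}"
  proof (subst openin_subopen, safe)
    fix x assume x: "x \<in> topspace X" "h x \<in> V"
    then obtain e where e: "e > 0" "\<And>z. dist z (h x) < e \<Longrightarrow> z \<in> V"
      using V unfolding open_dist by blast
    then obtain U where "openin X U" "x \<in> U" "\<forall>y\<in>U. dist (h x) (h y) < e"
      using assms x(1) by meson
    then show "\<exists>T. openin X T \<and> x \<in> T \<and> T \<subseteq> {x \<in> topspace X. h x \<in> V}"
      using e(2) openin_subset by (intro exI[of _ U]) (fastforce simp: dist_commute)
  qed
qed auto

lemma continuous_map_compact_bounded:
  fixes h :: "'a \<Rightarrow> 'b::real_normed_vector"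
  assumes "compact_space X" "continuous_map X euclidean h"
  obtains B where "B > 0" "\<And>x. x \<in> topspace X \<Longrightarrow> norm (h x) \<le> B"
proof -
  have "compact (h ` topspace X)"
    using image_compactin[OF _ assms(2), of "topspace X"] assms(1) by (simp add: compact_space_def)
  then have "bounded (h ` topspace X)" by (rule compact_imp_bounded)
  then show ?thesis
    using that unfolding bounded_pos by auto
qed

text \<open>This stands in for Haar measure and the Peter-Weyl theorem on the group generated by \<open>g\<close>. The
difference of an observable \<open>\<phi>\<close> along the orbits of \<open>y\<close> and \<open>y'\<close> is an almost periodic
sequence that is nonzero at time \<open>0\<close>; hence suitably modulated time averages of \<open>\<phi>\<close> differ at
\<open>y\<close> and \<open>y'\<close> by a fixed amount, for arbitrarily long averages. The averages are equicontinuous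
and each is an eigenfunction up to an error of order \<open>1 / n\<close>, so any cluster point is a
continuous eigenfunction that still separates the two points.\<close>

theorem equicontinuous_eigenfunctions_separate:
  fixes \<phi> :: "'a \<Rightarrow> real"
  assumes eq: "equicontinuous_system Y g" and comp: "compact_space Y"
    and bij: "bij_betw g (topspace Y) (topspace Y)"
    and cont: "continuous_map Y euclideanreal \<phi>"
    and y: "y \<in> topspace Y" "y' \<in> topspace Y" and sep: "\<phi> y \<noteq> \<phi> y'"
  obtains c h where "eigenfunction Y g c h" "h y \<noteq> h y'"
proof -
  obtain B where B: "B > 0" "\<And>z. z \<in> topspace Y \<Longrightarrow> \<bar>\<phi> z\<bar> \<le> B"
    using continuous_map_compact_bounded[OF comp cont] by (metis real_norm_def)
  have gin: "(g ^^ m) z \<in> topspace Y" if "z \<in> topspace Y" for m z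
    using int_iterate_in_topspace[OF bij that, of "int m"] by simp
  define a where "a n = \<phi> ((g ^^ n) y) - \<phi> ((g ^^ n) y')" for n
  have a_bound: "\<bar>a n\<bar> \<le> 2 * B" for n
    using B(2)[OF gin[OF y(1)], of n] B(2)[OF gin[OF y(2)], of n] unfolding a_def by linarith
  have a_nonzero: "a 0 \<noteq> 0" using sep by (simp add: a_def)
  obtain c0 n0 where c0: "c0 > 0"
    "\<And>n. n \<ge> n0 \<Longrightarrow> \<exists>z::complex. norm z = 1 \<and> c0 * real n \<le> norm (\<Sum>m<n. of_real (a m) * z ^ m)"
    using almost_periodic_trigonometric_sum[OF a_nonzero a_bound
        equicontinuous_almost_periodic[OF eq cont comp bij y, folded a_def]] by blast
  define z where "z n = (SOME z::complex. norm z = 1 \<and> (n \<ge> n0 \<longrightarrow> c0 * real n \<le> norm (\<Sum>m<n. of_real (a m) * z ^ m)))" for n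
  have z: "norm (z n) = 1 \<and> (n \<ge> n0 \<longrightarrow> c0 * real n \<le> norm (\<Sum>m<n. of_real (a m) * z n ^ m))" for n
    unfolding z_def by (rule someI_ex) (use c0(2)[of n] norm_one[where 'a = complex] in metis)
  \<comment> \<open>The value \<open>0\<close> off the space keeps \<open>H n\<close> in a product of closed discs.\<close>
  define H where "H n w = (if w \<in> topspace Y then (\<Sum>m<n. of_real (\<phi> ((g ^^ m) w)) * z n ^ m) / of_nat n else 0)" for n w
  have avg: "norm ((\<Sum>m<n. of_real (r m) * z n ^ m) / of_nat n) \<le> e"
    if "e \<ge> 0" "\<And>m. \<bar>r m\<bar> \<le> e" for r :: "nat \<Rightarrow> real" and n and e :: real
  proof (cases "n = 0")
    case False
    have "norm (\<Sum>m<n. of_real (r m) * z n ^ m) \<le> (\<Sum>m<n. e)"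
      using that(2) z by (intro sum_norm_le) (simp add: norm_mult norm_power)
    then show ?thesis using False by (simp add: norm_divide divide_le_eq mult.commute)
  qed (use that in simp)
  have Hdiff: "H n u - H n w = (\<Sum>m<n. of_real (\<phi> ((g ^^ m) u) - \<phi> ((g ^^ m) w)) * z n ^ m) / of_nat n"
    if "u \<in> topspace Y" "w \<in> topspace Y" for u w n
    using that by (simp add: H_def diff_divide_distrib sum_subtractf algebra_simps)
  have HB: "norm (H n w) \<le> B" for n w
    using avg[of B "\<lambda>m. \<phi> ((g ^^ m) w)" n] B gin by (auto simp: H_def)
  \<comment> \<open>By Tychonoff the pairs of multiplier and average have a cluster point, taken pointwise on \<open>Y\<close>.\<close>
  define K where "K = sphere (0::complex) 1 \<times> (UNIV \<rightarrow>\<^sub>E cball (0::complex) B :: ('a \<Rightarrow> complex) set)"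
  have "compactin (product_topology (\<lambda>_. euclidean) UNIV) (UNIV \<rightarrow>\<^sub>E cball (0::complex) B :: ('a \<Rightarrow> complex) set)"
    by (simp add: compactin_PiE)
  then have "compact K"
    unfolding K_def euclidean_product_topology compactin_euclidean_iff by (intro compact_Times compact_sphere)
  define G where "G = filtermap (\<lambda>n. (z n, H n)) sequentially"
  have "G \<noteq> bot" by (simp add: G_def filtermap_bot_iff)
  moreover have "eventually (\<lambda>q. q \<in> K) G"
    unfolding G_def eventually_filtermap K_def using z HB by (intro always_eventually) (auto simp: PiE_iff)
  ultimately obtain q where q: "inf (nhds q) G \<noteq> bot"
    using \<open>compact K\<close> unfolding compact_filter by blast
  obtain \<zeta> h where qq: "q = (\<zeta>, h)" by (cases q)
  \<comment> \<open>Along \<open>\<Phi>\<close> the multipliers and averages converge, and whatever holds for all large \<open>n\<close>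
     holds eventually.\<close>
  define \<Phi> where "\<Phi> = inf (nhds (\<zeta>, h)) G"
  have nb: "\<Phi> \<noteq> bot" using q by (simp add: \<Phi>_def qq)
  have evG: "eventually P \<Phi>" if "\<forall>\<^sub>F n in sequentially. P (z n, H n)" for P
    using that filter_leD[of \<Phi> G P] by (simp add: \<Phi>_def G_def eventually_filtermap)
  have lim: "((\<lambda>q. q) \<longlongrightarrow> (\<zeta>, h)) \<Phi>"
    unfolding filterlim_def \<Phi>_def by (simp add: filtermap_ident)
  have lim1: "(fst \<longlongrightarrow> \<zeta>) \<Phi>"
    using tendsto_fst[OF lim] by simp
  have lim2: "((\<lambda>q. snd q w) \<longlongrightarrow> h w) \<Phi>" for w
  proof -
    have "continuous_on UNIV (\<lambda>v :: 'a \<Rightarrow> complex. v w)"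
      by (rule continuous_on_product_coordinates)
    from continuous_on_tendsto_compose[OF this tendsto_snd[OF lim, unfolded snd_conv]] show ?thesis
      by simp
  qed
  have "norm \<zeta> = 1"
  proof (rule tendsto_unique[OF nb tendsto_norm[OF lim1] tendsto_eventually])
    show "\<forall>\<^sub>F q in \<Phi>. norm (fst q) = 1" by (rule evG) (simp add: z)
  qed
  have eig: "h (g w) * \<zeta> = h w" if w: "w \<in> topspace Y" for w
  proof -
    have small: "norm (H n (g w) * z n - H n w) \<le> 2 * B / real n" for n
    proof -
      have gw: "g w \<in> topspace Y" using gin[OF w, of 1] by simp
      have "H n (g w) * z n = (\<Sum>m<n. of_real (\<phi> ((g ^^ m) (g w))) * z n ^ m) * z n / of_nat n"
        using gw by (simp add: H_def)
      also have "\<dots> = (\<Sum>m<n. of_real (\<phi> ((g ^^ Suc m) w)) * z n ^ Suc m) / of_nat n"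
        unfolding sum_distrib_right funpow_Suc_right by (simp add: mult_ac)
      finally have "H n (g w) * z n - H n w = (\<Sum>m<n. of_real (\<phi> ((g ^^ Suc m) w)) * z n ^ Suc m
          - of_real (\<phi> ((g ^^ m) w)) * z n ^ m) / of_nat n"
        using w by (simp only: H_def if_True diff_divide_distrib sum_subtractf)
      also have "\<dots> = (of_real (\<phi> ((g ^^ n) w)) * z n ^ n - of_real (\<phi> w)) / of_nat n"
        unfolding sum_lessThan_telescope[of "\<lambda>m. of_real (\<phi> ((g ^^ m) w)) * z n ^ m" n] by simp
      finally have "norm (H n (g w) * z n - H n w) =
          norm (of_real (\<phi> ((g ^^ n) w)) * z n ^ n - of_real (\<phi> w)) / real n"
        by (simp add: norm_divide)
      also have "\<dots> \<le> (\<bar>\<phi> ((g ^^ n) w)\<bar> + \<bar>\<phi> w\<bar>) / real n"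
        using z by (intro divide_right_mono order_trans[OF norm_triangle_ineq4]) (auto simp: norm_mult norm_power)
      also have "\<dots> \<le> 2 * B / real n"
        using B(2)[OF gin[OF w], of n] B(2)[OF w] by (intro divide_right_mono) auto
      finally show ?thesis .
    qed
    have "norm (h (g w) * \<zeta> - h w) \<le> e" if "e > 0" for e
    proof (rule tendsto_upperbound)
      show "((\<lambda>q. norm (snd q (g w) * fst q - snd q w)) \<longlongrightarrow> norm (h (g w) * \<zeta> - h w)) \<Phi>"
        by (intro tendsto_intros lim1 lim2)
      have "(\<lambda>n. 2 * B / real n) \<longlonglongrightarrow> 0" by (rule lim_const_over_n)
      then have "\<forall>\<^sub>F n in sequentially. 2 * B / real n < e"
        using \<open>e > 0\<close> by (rule order_tendstoD)
      then show "\<forall>\<^sub>F q in \<Phi>. norm (snd q (g w) * fst q - snd q w) \<le> e"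
        by (intro evG) (auto elim!: eventually_mono intro: order_trans[OF small])
    qed (rule nb)
    then have "norm (h (g w) * \<zeta> - h w) \<le> 0"
      by (rule field_le_epsilon) simp
    then show ?thesis by simp
  qed
  have conth: "continuous_map Y euclidean h"
  proof (rule continuous_map_into_metric)
    fix x and e :: real assume x: "x \<in> topspace Y" and "e > 0"
    obtain U where U: "openin Y U" "x \<in> U"
      "\<And>z n. z \<in> U \<Longrightarrow> \<bar>\<phi> (int_iterate Y g n x) - \<phi> (int_iterate Y g n z)\<bar> < e / 2"
      using equicontinuous_system_observable[OF eq cont half_gt_zero[OF \<open>e > 0\<close>] x] by metis
    have "dist (h x) (h u) < e" if u: "u \<in> U" for u
    proof -
      have uY: "u \<in> topspace Y" using U(1) u openin_subset by blast
      have "norm (H n x - H n u) \<le> e / 2" for n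
        unfolding Hdiff[OF x uY] using U(3)[OF u, of "int _"] \<open>e > 0\<close>
        by (intro avg) (auto intro: less_imp_le)
      then have "norm (h x - h u) \<le> e / 2"
        by (intro tendsto_upperbound[OF tendsto_norm[OF tendsto_diff[OF lim2 lim2]] _ nb] evG) simp
      then show ?thesis using \<open>e > 0\<close> by (simp add: dist_norm)
    qed
    then show "\<exists>U. openin Y U \<and> x \<in> U \<and> (\<forall>y\<in>U. dist (h x) (h y) < e)"
      using U by blast
  qed
  have "c0 \<le> norm (h y - h y')"
  proof (rule tendsto_lowerbound[OF tendsto_norm[OF tendsto_diff[OF lim2 lim2]] _ nb], rule evG)
    show "\<forall>\<^sub>F n in sequentially. c0 \<le> norm (snd (z n, H n) y - snd (z n, H n) y')"
      using eventually_ge_at_top[of n0] eventually_gt_at_top[of 0]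
    proof eventually_elim
      case (elim n)
      then have "c0 * real n \<le> norm (\<Sum>m<n. of_real (a m) * z n ^ m)" using z by blast
      then show ?case
        using elim by (simp add: Hdiff[OF y] norm_divide a_def le_divide_eq)
    qed
  qed
  then have "h y \<noteq> h y'" using c0(1) by auto
  moreover have "eigenfunction Y g (inverse \<zeta>) h"
    unfolding eigenfunction_def
  proof (intro conjI ballI)
    fix x assume "x \<in> topspace Y"
    then have "h x = h (g x) * \<zeta>" using eig by simp
    moreover have "\<zeta> \<noteq> 0" using \<open>norm \<zeta> = 1\<close> by auto
    ultimately show "h (g x) = inverse \<zeta> * h x" by simp
  qed (use conth \<open>norm \<zeta> = 1\<close> in \<open>auto simp: norm_inverse\<close>)
  ultimately show ?thesis using that by blast
qed

lemma eigenfunction_int_iterate: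
  assumes h: "eigenfunction X f c h" and bij: "bij_betw f (topspace X) (topspace X)"
    and x: "x \<in> topspace X"
  shows "h (int_iterate X f n x) = c powi n * h x"
proof -
  have c: "c \<noteq> 0" and step: "\<And>y. y \<in> topspace X \<Longrightarrow> h (f y) = c * h y"
    using h by (auto simp: eigenfunction_def)
  have succ: "h (int_iterate X f (i + 1) x) = c * h (int_iterate X f i x)" for i
    using step int_iterate_in_topspace[OF bij x] int_iterate_add_one[OF bij x] by simp
  show ?thesis
  proof (induction n rule: int_induct[of _ 0])
    case (step1 i)
    then show ?case using c succ[of i] by (simp add: power_int_add_1')
  next
    case (step2 i)
    have "c * h (int_iterate X f (i - 1) x) = c * (c powi (i - 1) * h x)"
      using step2 c succ[of "i - 1"] by (simp add: power_int_diff)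
    then show ?case using c by simp
  qed simp
qed

text \<open>An eigenfunction varies by the same amount between the \<open>n\<close>-th iterates of two points for every
\<open>n\<close>, and by compactness closeness in finitely many eigenfunctions already implies closeness in a
given entourage \<open>V\<close>.\<close>

lemma eigenfunctions_separate_imp_equicontinuous:
  assumes comp: "compact_space Y" and bij: "bij_betw g (topspace Y) (topspace Y)"
    and sep: "\<And>y y'. \<lbrakk>y \<in> topspace Y; y' \<in> topspace Y; y \<noteq> y'\<rbrakk> \<Longrightarrow> \<exists>c h. eigenfunction Y g c h \<and> h y \<noteq> h y'"
  shows "equicontinuous_system Y g"
  unfolding equicontinuous_system_def
proof (intro allI impI ballI)
  fix V x
  assume "openin (prod_topology Y Y) V \<and> (\<forall>x\<in>topspace Y. (x, x) \<in> V)" and x: "x \<in> topspace Y"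
  then have V: "openin (prod_topology Y Y) V" "\<And>x. x \<in> topspace Y \<Longrightarrow> (x, x) \<in> V" by auto
  let ?YY = "topspace (prod_topology Y Y)"
  define K where "K = ?YY - V"
  have "compactin (prod_topology Y Y) K"
    unfolding K_def using comp V(1)
    by (intro closedin_compact_space closedin_diff openin_topspace closedin_topspace)
      (auto simp: compact_space_prod_topology)
  have "\<forall>p\<in>K. \<exists>c h. eigenfunction Y g c h \<and> h (fst p) \<noteq> h (snd p)"
    using sep V(2) by (force simp: K_def)
  then obtain c h where ch: "\<And>p. p \<in> K \<Longrightarrow> eigenfunction Y g (c p) (h p) \<and> h p (fst p) \<noteq> h p (snd p)"
    by metis
  define e where "e p = norm (h p (fst p) - h p (snd p)) / 2" for p
  define W where "W p = {q \<in> ?YY. norm (h p (fst q) - h p (snd q)) \<in> {e p<..}}" for p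
  have cont: "continuous_map Y euclidean (h p)" if "p \<in> K" for p
    using ch[OF that] by (simp add: eigenfunction_def)
  have openW: "openin (prod_topology Y Y) (W p)" if "p \<in> K" for p
    unfolding W_def
    by (rule openin_continuous_map_preimage[where Y = euclideanreal])
      (auto intro!: continuous_intros continuous_map_compose[OF continuous_map_fst cont[OF that], unfolded o_def]
        continuous_map_compose[OF continuous_map_snd cont[OF that], unfolded o_def])
  have "K \<subseteq> \<Union>(W ` K)"
    using ch by (auto simp: W_def e_def K_def)
  moreover have "\<And>U. U \<in> W ` K \<Longrightarrow> openin (prod_topology Y Y) U" using openW by auto
  ultimately obtain \<F> where "finite \<F>" "\<F> \<subseteq> W ` K" "K \<subseteq> \<Union>\<F>"
    using \<open>compactin (prod_topology Y Y) K\<close> unfolding compactin_def by metis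
  then obtain P where P: "finite P" "P \<subseteq> K" "K \<subseteq> \<Union>(W ` P)"
    by (metis finite_subset_image)
  define U where "U = {z \<in> topspace Y. \<forall>p\<in>P. norm (h p x - h p z) \<in> {..<e p}}"
  have "openin Y ({z \<in> topspace Y. norm (h p x - h p z) \<in> {..<e p}})" if "p \<in> P" for p
    using cont[of p] that P(2)
    by (intro openin_continuous_map_preimage[where Y = euclideanreal])
      (auto intro!: continuous_intros)
  then have "openin Y (topspace Y \<inter> (\<Inter>p\<in>P. {z \<in> topspace Y. norm (h p x - h p z) \<in> {..<e p}}))"
    using P(1) by (cases "P = {}") (auto intro!: openin_Int openin_INT)
  moreover have "topspace Y \<inter> (\<Inter>p\<in>P. {z \<in> topspace Y. norm (h p x - h p z) \<in> {..<e p}}) = U"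
    by (auto simp: U_def)
  ultimately have "openin Y U" by simp
  moreover have "x \<in> U"
    using x P(2) ch by (auto simp: U_def e_def)
  moreover have "(int_iterate Y g n x, int_iterate Y g n z) \<in> V" if z: "z \<in> U" for z n
  proof (rule ccontr)
    assume notV: "\<not> ?thesis"
    have zY: "z \<in> topspace Y" using z by (simp add: U_def)
    let ?q = "(int_iterate Y g n x, int_iterate Y g n z)"
    have "?q \<in> K"
      using notV int_iterate_in_topspace[OF bij x] int_iterate_in_topspace[OF bij zY]
      by (simp add: K_def)
    then obtain p where p: "p \<in> P" "?q \<in> W p" using P(3) by blast
    then have E: "eigenfunction Y g (c p) (h p)" using ch P(2) by blast
    have "norm (h p (int_iterate Y g n x) - h p (int_iterate Y g n z)) = norm (c p powi n * (h p x - h p z))"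
      using eigenfunction_int_iterate[OF E bij] x zY by (simp add: right_diff_distrib)
    also have "\<dots> = norm (h p x - h p z)"
      using E by (simp add: norm_mult norm_power_int eigenfunction_def)
    also have "\<dots> < e p" using z p(1) by (simp add: U_def)
    finally show False using p(2) by (simp add: W_def)
  qed
  ultimately show "\<exists>U. openin Y U \<and> x \<in> U \<and> (\<forall>y\<in>U. \<forall>n. (int_iterate Y g n x, int_iterate Y g n y) \<in> V)"
    by blast
qed

section \<open>The equicontinuous structure relation\<close>

lemma closed_map_quotient_topology:
  assumes comp: "compact_space X" and haus: "Hausdorff_space X"
    and R: "equiv (topspace X) R" "closedin (prod_topology X X) R"
  shows "closed_map X (quotient_topology X R) (\<lambda>x. R `` {x})"
  unfolding closed_map_def
proof (intro allI impI)
  fix C assume C: "closedin X C"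
  have CX: "C \<subseteq> topspace X" using C closedin_subset by blast
  \<comment> \<open>The saturation of \<open>C\<close> is the projection of this compact set.\<close>
  have "closedin (prod_topology X X) (R \<inter> C \<times> topspace X)"
    using R(2) C by (intro closedin_Int) (auto simp: closedin_prod_Times_iff)
  then have "compactin (prod_topology X X) (R \<inter> C \<times> topspace X)"
    using comp by (intro closedin_compact_space) (auto simp: compact_space_prod_topology)
  then have "closedin X (snd ` (R \<inter> C \<times> topspace X))"
    using haus image_compactin[OF _ continuous_map_snd] compactin_imp_closedin by blast
  moreover have "snd ` (R \<inter> C \<times> topspace X) = {x \<in> topspace X. R `` {x} \<in> (\<lambda>x. R `` {x}) ` C}"
  proof -
    have "(\<exists>c\<in>C. (c, x) \<in> R) \<longleftrightarrow> R `` {x} \<in> (\<lambda>x. R `` {x}) ` C" if "x \<in> topspace X" for x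
      using eq_equiv_class_iff[OF R(1)] that CX by (auto simp: image_iff) blast+
    then have "{x \<in> topspace X. R `` {x} \<in> (\<lambda>x. R `` {x}) ` C} = {x \<in> topspace X. \<exists>c\<in>C. (c, x) \<in> R}"
      by blast
    also have "\<dots> = snd ` (R \<inter> C \<times> topspace X)" by force
    finally show ?thesis ..
  qed
  moreover have "(\<lambda>x. R `` {x}) ` C \<subseteq> topspace (quotient_topology X R)"
    using CX by (auto intro: quotientI)
  ultimately show "closedin (quotient_topology X R) ((\<lambda>x. R `` {x}) ` C)"
    using quotient_map_quotient_topology[of X R] unfolding quotient_map_closedin by auto
qed

lemma quotient_topology_compact_normal_Hausdorff:
  assumes "compact_space X" "Hausdorff_space X"
    and "equiv (topspace X) R" "closedin (prod_topology X X) R"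
  shows "compact_space (quotient_topology X R)"
    and "normal_space (quotient_topology X R)" "Hausdorff_space (quotient_topology X R)"
proof -
  let ?p = "\<lambda>x. R `` {x}"
  have q: "continuous_map X (quotient_topology X R) ?p" "?p ` topspace X = topspace (quotient_topology X R)"
    using quotient_map_quotient_topology[of X R]
    by (auto simp: quotient_imp_continuous_map quotient_imp_surjective_map)
  show "compact_space (quotient_topology X R)"
    using image_compactin[OF _ q(1), of "topspace X"] assms(1) q(2) by (simp add: compact_space_def)
  show "normal_space (quotient_topology X R)" "Hausdorff_space (quotient_topology X R)"
    using normal_Hausdorff_space_closed_continuous_map_image[OF _ assms(2) closed_map_quotient_topology[OF assms] q]
      compact_Hausdorff_or_regular_imp_normal_space[OF assms(1)] assms(2) by blast+
qed

lemma closed_invariant_equiv_induced_map: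
  assumes "closed_invariant_equiv X f R" "x \<in> topspace X"
  shows "induced_map R f (R `` {x}) = R `` {f x}"
proof (rule induced_map_class[of "topspace X"])
  show "equiv (topspace X) R" using assms(1) by (simp add: closed_invariant_equiv_def)
  then have "R \<subseteq> topspace X \<times> topspace X" by (rule equiv_type)
  then show "(f x, f y) \<in> R" if "(x, y) \<in> R" for x y
    using assms(1) that by (auto simp: closed_invariant_equiv_def)
qed (rule assms(2))

lemma closed_invariant_equiv_bij_betw:
  assumes R: "closed_invariant_equiv X f R" and f: "bij_betw f (topspace X) (topspace X)"
  shows "bij_betw (induced_map R f) (topspace (quotient_topology X R)) (topspace (quotient_topology X R))"
proof -
  have eqv: "equiv (topspace X) R" using R by (simp add: closed_invariant_equiv_def)
  have "inj_on (induced_map R f) (topspace X // R)"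
  proof (rule inj_onI)
    fix C D assume CD: "C \<in> topspace X // R" "D \<in> topspace X // R" "induced_map R f C = induced_map R f D"
    then obtain x y where xy: "C = R `` {x}" "D = R `` {y}" "x \<in> topspace X" "y \<in> topspace X"
      by (auto elim!: quotientE)
    have fxy: "f x \<in> topspace X" "f y \<in> topspace X" using f xy by (auto simp: bij_betw_def)
    have "R `` {f x} = R `` {f y}"
      using CD(3) xy closed_invariant_equiv_induced_map[OF R] by simp
    then have "(f x, f y) \<in> R" using eq_equiv_class_iff[OF eqv fxy] by simp
    then have "(x, y) \<in> R" using R xy by (auto simp: closed_invariant_equiv_def)
    then show "C = D" using equiv_class_eq[OF eqv] xy by simp
  qed
  moreover have "induced_map R f ` (topspace X // R) = topspace X // R"
  proof -
    have "topspace X // R = (\<lambda>x. R `` {x}) ` topspace X"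
      by (auto simp: quotient_def)
    moreover have "(\<lambda>x. R `` {f x}) ` topspace X = (\<lambda>x. R `` {x}) ` topspace X"
      using f image_image[of "\<lambda>x. R `` {x}" f "topspace X"] by (simp add: bij_betw_def)
    ultimately show ?thesis
      using f closed_invariant_equiv_induced_map[OF R] unfolding bij_betw_def by (simp add: image_image)
  qed
  ultimately show ?thesis by (simp add: bij_betw_def)
qed

definition eigenfunction_relation :: "'a topology \<Rightarrow> ('a \<Rightarrow> 'a) \<Rightarrow> ('a \<times> 'a) set" where
  "eigenfunction_relation X f =
     {(x, y) \<in> topspace X \<times> topspace X. \<forall>c h. eigenfunction X f c h \<longrightarrow> h x = h y}"

lemma eigenfunction_relation_iff:
  "(x, y) \<in> eigenfunction_relation X f \<longleftrightarrow>
     x \<in> topspace X \<and> y \<in> topspace X \<and> (\<forall>c h. eigenfunction X f c h \<longrightarrow> h x = h y)"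
  by (simp add: eigenfunction_relation_def)

lemma closed_invariant_equiv_eigenfunction_relation:
  assumes f: "bij_betw f (topspace X) (topspace X)"
  shows "closed_invariant_equiv X f (eigenfunction_relation X f)"
proof -
  have "equiv (topspace X) (eigenfunction_relation X f)"
  proof (rule equivI)
    show "eigenfunction_relation X f \<subseteq> topspace X \<times> topspace X"
      by (auto simp: eigenfunction_relation_iff)
    show "refl_on (topspace X) (eigenfunction_relation X f)"
      by (rule refl_onI) (simp add: eigenfunction_relation_iff)
    show "sym (eigenfunction_relation X f)" "trans (eigenfunction_relation X f)"
      unfolding sym_def trans_def by (metis eigenfunction_relation_iff)+
  qed
  moreover have "closedin (prod_topology X X) (eigenfunction_relation X f)"
  proof -
    have 0: "eigenfunction X f 1 (\<lambda>_. 0)"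
      by (simp add: eigenfunction_def)
    let ?D = "\<lambda>h::'a \<Rightarrow> complex. {p \<in> topspace (prod_topology X X). h (fst p) - h (snd p) \<in> {0}}"
    have D: "closedin (prod_topology X X) (?D h)" if "eigenfunction X f c h" for c h
    proof (rule closedin_continuous_map_preimage[where Y = euclidean])
      have "continuous_map X euclidean h" using that by (simp add: eigenfunction_def)
      then show "continuous_map (prod_topology X X) euclidean (\<lambda>p. h (fst p) - h (snd p))"
        by (intro continuous_intros continuous_map_compose[OF continuous_map_fst, unfolded o_def]
            continuous_map_compose[OF continuous_map_snd, unfolded o_def])
    qed simp
    have "eigenfunction_relation X f = (\<Inter>h\<in>{h. \<exists>c. eigenfunction X f c h}. ?D h)"
      using 0 by (auto simp: eigenfunction_relation_iff) blast+
    also have "closedin (prod_topology X X) \<dots>"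
      using 0 D by (intro closedin_INT) auto
    finally show ?thesis .
  qed
  moreover have "(x, y) \<in> eigenfunction_relation X f \<longleftrightarrow> (f x, f y) \<in> eigenfunction_relation X f"
    if xy: "x \<in> topspace X" "y \<in> topspace X" for x y
  proof -
    have "f x \<in> topspace X" "f y \<in> topspace X" using f xy by (auto simp: bij_betw_def)
    moreover have "h (f x) = h (f y) \<longleftrightarrow> h x = h y" if "eigenfunction X f c h" for c h
      using that xy by (auto simp: eigenfunction_def)
    ultimately show ?thesis using xy by (auto simp: eigenfunction_relation_def)
  qed
  ultimately show ?thesis by (simp add: closed_invariant_equiv_def)
qed

lemma eigenfunction_descends:
  assumes f: "bij_betw f (topspace X) (topspace X)" and h: "eigenfunction X f c h"
  defines "R \<equiv> eigenfunction_relation X f"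
  obtains k where "eigenfunction (quotient_topology X R) (induced_map R f) c k"
    "\<And>x. x \<in> topspace X \<Longrightarrow> k (R `` {x}) = h x"
proof -
  have R: "closed_invariant_equiv X f R"
    unfolding R_def by (rule closed_invariant_equiv_eigenfunction_relation[OF f])
  then have eqv: "equiv (topspace X) R" by (simp add: closed_invariant_equiv_def)
  have hc: "continuous_map X euclidean h" using h by (simp add: eigenfunction_def)
  have const: "h x = h y" if "x \<in> topspace X" "y \<in> topspace X" "R `` {x} = R `` {y}" for x y
  proof -
    have "(x, y) \<in> R" using that eq_equiv_class_iff[OF eqv] by simp
    then show ?thesis using h by (auto simp: R_def eigenfunction_relation_def)
  qed
  obtain k where k: "continuous_map (quotient_topology X R) euclidean k"
    "\<And>x. x \<in> topspace X \<Longrightarrow> k (R `` {x}) = h x"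
    by (rule quotient_map_lift_exists[OF quotient_map_quotient_topology[of X R] hc]) (use const in blast)+
  have "k (induced_map R f C) = c * k C" if C: "C \<in> topspace X // R" for C
  proof -
    obtain x where x: "C = R `` {x}" "x \<in> topspace X" using C by (rule quotientE)
    moreover have "f x \<in> topspace X" using f x by (auto simp: bij_betw_def)
    ultimately show ?thesis
      using closed_invariant_equiv_induced_map[OF R x(2)] k(2) h by (simp add: eigenfunction_def)
  qed
  then have "eigenfunction (quotient_topology X R) (induced_map R f) c k"
    using k(1) h by (simp add: eigenfunction_def)
  then show ?thesis using k(2) by (rule that)
qed

text \<open>The least relation exists because it can be written down: two points are identified iff no
continuous eigenfunction tells them apart. The quotient by this relation is equicontinuous since
its points are separated by eigenfunctions. Conversely, distinct points of any equicontinuous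
Hausdorff quotient are separated by a continuous observable (Urysohn), hence by an eigenfunction,
whose pullback to \<open>X\<close> separates their preimages.\<close>

theorem equicontinuous_structure_relation_eq:
  assumes comp: "compact_space X" and haus: "Hausdorff_space X" and homeo: "homeomorphic_map X X f"
  shows "equicontinuous_structure_relation X f = eigenfunction_relation X f"
  unfolding equicontinuous_structure_relation_def
proof (rule Least_equality)
  have f: "bij_betw f (topspace X) (topspace X)"
    using homeo by (simp add: bij_betw_def homeomorphic_eq_everything_map)
  let ?S = "eigenfunction_relation X f"
  have S: "closed_invariant_equiv X f ?S"
    by (rule closed_invariant_equiv_eigenfunction_relation[OF f])
  have "equicontinuous_system (quotient_topology X ?S) (induced_map ?S f)"
  proof (rule eigenfunctions_separate_imp_equicontinuous)
    show "compact_space (quotient_topology X ?S)"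
      using quotient_topology_compact_normal_Hausdorff(1)[OF comp haus] S
      by (simp add: closed_invariant_equiv_def)
    show "bij_betw (induced_map ?S f) (topspace (quotient_topology X ?S)) (topspace (quotient_topology X ?S))"
      by (rule closed_invariant_equiv_bij_betw[OF S f])
    fix C D assume CD: "C \<in> topspace (quotient_topology X ?S)" "D \<in> topspace (quotient_topology X ?S)" "C \<noteq> D"
    then obtain x y where xy: "C = ?S `` {x}" "D = ?S `` {y}" "x \<in> topspace X" "y \<in> topspace X"
      by (auto elim!: quotientE)
    then have "(x, y) \<notin> ?S"
      using CD(3) S equiv_class_eq[of "topspace X" ?S x y] by (auto simp: closed_invariant_equiv_def)
    then obtain c h where h: "eigenfunction X f c h" "h x \<noteq> h y"
      using xy by (auto simp: eigenfunction_relation_def)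
    obtain k where "eigenfunction (quotient_topology X ?S) (induced_map ?S f) c k"
      "\<And>x. x \<in> topspace X \<Longrightarrow> k (?S `` {x}) = h x"
      using eigenfunction_descends[OF f h(1)] by metis
    then show "\<exists>c k. eigenfunction (quotient_topology X ?S) (induced_map ?S f) c k \<and> k C \<noteq> k D"
      using xy h(2) by metis
  qed
  then show "closed_invariant_equiv X f ?S \<and> equicontinuous_system (quotient_topology X ?S) (induced_map ?S f)"
    using S by simp
  fix R assume "closed_invariant_equiv X f R \<and> equicontinuous_system (quotient_topology X R) (induced_map R f)"
  then have R: "closed_invariant_equiv X f R"
    and equi: "equicontinuous_system (quotient_topology X R) (induced_map R f)" by auto
  let ?Y = "quotient_topology X R"
  have eqv: "equiv (topspace X) R" and cl: "closedin (prod_topology X X) R"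
    using R by (auto simp: closed_invariant_equiv_def)
  note Y = quotient_topology_compact_normal_Hausdorff[OF comp haus eqv cl]
  show "?S \<le> R"
  proof (rule subsetI, clarify, rule ccontr)
    fix x y assume xy: "(x, y) \<in> ?S" "(x, y) \<notin> R"
    then have xyX: "x \<in> topspace X" "y \<in> topspace X" by (auto simp: eigenfunction_relation_def)
    let ?C = "R `` {x}" and ?D = "R `` {y}"
    have CD: "?C \<in> topspace ?Y" "?D \<in> topspace ?Y" "?C \<noteq> ?D"
      using xyX xy(2) eq_equiv_class_iff[OF eqv] by (auto intro: quotientI)
    have "closedin ?Y {?C}" "closedin ?Y {?D}" "disjnt {?C} {?D}"
      using Y(3) CD by (auto simp: closedin_Hausdorff_singleton)
    then obtain \<phi> where \<phi>: "continuous_map ?Y euclideanreal \<phi>" "\<phi> ` {?C} \<subseteq> {0}" "\<phi> ` {?D} \<subseteq> {1}"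
      using Y(2) unfolding normal_space_iff_Urysohn_alt by meson
    then have "\<phi> ?C \<noteq> \<phi> ?D" by auto
    then obtain c k where k: "eigenfunction ?Y (induced_map R f) c k" "k ?C \<noteq> k ?D"
      using equicontinuous_eigenfunctions_separate[OF equi Y(1) closed_invariant_equiv_bij_betw[OF R f] \<phi>(1) CD(1,2)]
      by metis
    have "eigenfunction X f c (\<lambda>x. k (R `` {x}))"
      unfolding eigenfunction_def
    proof (intro conjI ballI)
      show "continuous_map X euclidean (\<lambda>x. k (R `` {x}))"
        using continuous_map_compose[OF quotient_imp_continuous_map[OF quotient_map_quotient_topology]] k(1)
        by (auto simp: eigenfunction_def o_def)
      show "norm c = 1" using k(1) by (simp add: eigenfunction_def)
      fix x assume x: "x \<in> topspace X"
      then have "R `` {x} \<in> topspace ?Y" by (auto intro: quotientI)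
      then show "k (R `` {f x}) = c * k (R `` {x})"
        using k(1) closed_invariant_equiv_induced_map[OF R x] by (metis eigenfunction_def)
    qed
    then show False using xy(1) k(2) by (auto simp: eigenfunction_relation_def)
  qed
qed

text \<open>An invariant function is an eigenfunction with eigenvalue \<open>1\<close>, so it factors through the maximal
equicontinuous factor, where it is constant on a dense orbit.\<close>

lemma minimal_mef_invariant_constant:
  fixes h :: "'a \<Rightarrow> complex"
  assumes comp: "compact_space X" and haus: "Hausdorff_space X" and homeo: "homeomorphic_map X X f"
    and minim: "minimal_system (mef_space X f) (mef_map X f)"
    and h: "eigenfunction X f 1 h" and xy: "x \<in> topspace X" "y \<in> topspace X"
  shows "h x = h y"
proof -
  have f: "bij_betw f (topspace X) (topspace X)"
    using homeo by (simp add: bij_betw_def homeomorphic_eq_everything_map)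
  let ?S = "eigenfunction_relation X f"
  let ?Y = "quotient_topology X ?S" and ?g = "induced_map ?S f"
  have Y: "mef_space X f = ?Y" "mef_map X f = ?g"
    by (simp_all add: mef_space_def mef_map_def equicontinuous_structure_relation_eq[OF comp haus homeo])
  obtain k where k: "eigenfunction ?Y ?g 1 k" "\<And>x. x \<in> topspace X \<Longrightarrow> k (?S `` {x}) = h x"
    using eigenfunction_descends[OF f h] by metis
  let ?C = "?S `` {x}" and ?D = "?S `` {y}"
  have CD: "?C \<in> topspace ?Y" "?D \<in> topspace ?Y" using xy by (auto intro: quotientI)
  have bij: "bij_betw ?g (topspace ?Y) (topspace ?Y)"
    by (intro closed_invariant_equiv_bij_betw closed_invariant_equiv_eigenfunction_relation f)
  have "closedin ?Y {z \<in> topspace ?Y. k z \<in> {k ?C}}"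
    using k(1) by (intro closedin_continuous_map_preimage[where Y = euclidean]) (auto simp: eigenfunction_def)
  moreover have "range (\<lambda>n. int_iterate ?Y ?g n ?C) \<subseteq> {z \<in> topspace ?Y. k z \<in> {k ?C}}"
    using eigenfunction_int_iterate[OF k(1) bij CD(1)] int_iterate_in_topspace[OF bij CD(1)] by auto
  ultimately have "?Y closure_of range (\<lambda>n. int_iterate ?Y ?g n ?C) \<subseteq> {z \<in> topspace ?Y. k z \<in> {k ?C}}"
    by (intro closure_of_minimal)
  then have "?D \<in> {z \<in> topspace ?Y. k z \<in> {k ?C}}"
    using minim CD unfolding minimal_system_def Y by blast
  then show ?thesis using k(2) xy by simp
qed

section \<open>The torus and the circle\<close>

lemma equiv_torus_rel: "equiv UNIV torus_rel"
proof (intro equivI refl_onI symI transI)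
  fix x y z assume "(x, y) \<in> torus_rel" "(y, z) \<in> torus_rel"
  then show "(x, z) \<in> torus_rel"
    using Ints_add[of "fst x - fst y" "fst y - fst z"] Ints_add[of "snd x - snd y" "snd y - snd z"]
    by (simp add: torus_rel_def)
next
  fix x y assume "(x, y) \<in> torus_rel"
  then have "- (fst x - fst y) \<in> \<int>" "- (snd x - snd y) \<in> \<int>"
    by (auto simp: torus_rel_def simp del: minus_diff_eq intro: Ints_minus)
  then show "(y, x) \<in> torus_rel" by (simp add: torus_rel_def)
qed (auto simp: torus_rel_def)

lemma equiv_circle_rel: "equiv UNIV circle_rel"
proof (intro equivI refl_onI symI transI)
  fix x y z assume "(x, y) \<in> circle_rel" "(y, z) \<in> circle_rel"
  then show "(x, z) \<in> circle_rel"
    using Ints_add[of "x - y" "y - z"] by (simp add: circle_rel_def)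
next
  fix x y assume "(x, y) \<in> circle_rel"
  then have "- (x - y) \<in> \<int>" by (auto simp: circle_rel_def simp del: minus_diff_eq intro: Ints_minus)
  then show "(y, x) \<in> circle_rel" by (simp add: circle_rel_def)
qed (auto simp: circle_rel_def)

lemma torus_class_eq_iff:
  "torus_rel `` {x} = torus_rel `` {y} \<longleftrightarrow> fst x - fst y \<in> \<int> \<and> snd x - snd y \<in> \<int>"
  using eq_equiv_class_iff[OF equiv_torus_rel, of x y] by (simp add: torus_rel_def)

lemma circle_class_eq_iff: "circle_rel `` {x} = circle_rel `` {y} \<longleftrightarrow> x - y \<in> \<int>"
  using eq_equiv_class_iff[OF equiv_circle_rel, of x y] by (simp add: circle_rel_def)

lemma topspace_torus: "topspace torus = range (\<lambda>x. torus_rel `` {x})"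
  by (auto simp: torus_def quotient_def)

lemma topspace_circle: "topspace circle = range (\<lambda>x. circle_rel `` {x})"
  by (auto simp: circle_def quotient_def)

lemma torus_class_in [simp]: "torus_rel `` {x} \<in> topspace torus"
  by (simp add: topspace_torus)

lemma circle_class_in [simp]: "circle_rel `` {x} \<in> topspace circle"
  by (simp add: topspace_circle)

lemma continuous_map_torus_iff:
  fixes h :: "(real \<times> real) set \<Rightarrow> 'b::topological_space"
  shows "continuous_map torus euclidean h \<longleftrightarrow> continuous_on UNIV (\<lambda>x. h (torus_rel `` {x}))"
  unfolding torus_def continuous_compose_quotient_map_eq[OF quotient_map_quotient_topology, symmetric]
  by (simp add: o_def)

lemma continuous_map_circle_iff:
  fixes h :: "real set \<Rightarrow> 'b::topological_space"
  shows "continuous_map circle euclidean h \<longleftrightarrow> continuous_on UNIV (\<lambda>x. h (circle_rel `` {x}))"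
  unfolding circle_def continuous_compose_quotient_map_eq[OF quotient_map_quotient_topology, symmetric]
  by (simp add: o_def)

lemma compact_space_torus: "compact_space torus"
proof -
  let ?p = "\<lambda>x. torus_rel `` {x}"
  have "continuous_map euclidean torus ?p"
    unfolding torus_def by (rule quotient_imp_continuous_map[OF quotient_map_quotient_topology])
  moreover have "compactin euclidean ({0..1} \<times> {0..1::real} :: (real \<times> real) set)"
    by (simp add: compact_Times)
  ultimately have "compactin torus (?p ` ({0..1} \<times> {0..1}))" by (intro image_compactin)
  moreover have "?p ` ({0..1} \<times> {0..1}) = topspace torus"
  proof -
    have "?p x \<in> ?p ` ({0..1} \<times> {0..1})" for x
    proof (rule image_eqI)
      show "?p x = ?p (frac (fst x), frac (snd x))"
        by (simp add: torus_class_eq_iff frac_def)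
      show "(frac (fst x), frac (snd x)) \<in> {0..1} \<times> {0..1}"
        by (simp add: frac_ge_0 frac_lt_1 less_imp_le)
    qed
    then show ?thesis by (auto simp: topspace_torus)
  qed
  ultimately show ?thesis by (simp add: compact_space_def)
qed

lemma compact_space_circle: "compact_space circle"
proof -
  let ?p = "\<lambda>x. circle_rel `` {x}"
  have "continuous_map euclidean circle ?p"
    unfolding circle_def by (rule quotient_imp_continuous_map[OF quotient_map_quotient_topology])
  moreover have "compactin euclidean {0..1::real}" by simp
  ultimately have "compactin circle (?p ` {0..1})" by (intro image_compactin)
  moreover have "?p ` {0..1} = topspace circle"
  proof -
    have "?p x \<in> ?p ` {0..1}" for x
    proof (rule image_eqI)
      show "?p x = ?p (frac x)" by (simp add: circle_class_eq_iff frac_def)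
      show "frac x \<in> {0..1}" by (simp add: frac_ge_0 frac_lt_1 less_imp_le)
    qed
    then show ?thesis by (auto simp: topspace_circle)
  qed
  ultimately show ?thesis by (simp add: compact_space_def)
qed

lemma cis_2pi_eq_iff: "cis (2 * pi * s) = cis (2 * pi * t) \<longleftrightarrow> s - t \<in> \<int>"
proof
  assume "s - t \<in> \<int>"
  then have "cis (2 * pi * (s - t)) = 1" by (rule cis_multiple_2pi)
  moreover have "cis (2 * pi * s) = cis (2 * pi * t) * cis (2 * pi * (s - t))"
    by (simp add: cis_mult algebra_simps)
  ultimately show "cis (2 * pi * s) = cis (2 * pi * t)" by simp
next
  assume "cis (2 * pi * s) = cis (2 * pi * t)"
  then have "cis (2 * pi * s) / cis (2 * pi * t) = 1" by simp
  then have "cis (2 * pi * (s - t)) = 1" by (simp add: cis_divide algebra_simps)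
  then have "cos (2 * pi * (s - t)) = 1" by (simp add: complex_eq_iff)
  then obtain k :: int where "2 * pi * (s - t) = of_int k * 2 * pi"
    by (auto simp: cos_one_2pi_int)
  then have "s - t = of_int k" by simp
  then show "s - t \<in> \<int>" by simp
qed

lemma unit_complex_eq_cis_2pi:
  assumes "norm z = 1" obtains t where "z = cis (2 * pi * t)"
proof
  have "z \<noteq> 0" using assms by auto
  then show "z = cis (2 * pi * (Arg z / (2 * pi)))"
    using cis_Arg[of z] assms by (simp add: sgn_eq)
qed

lemma torus_embedding:
  obtains E :: "(real \<times> real) set \<Rightarrow> complex \<times> complex"
  where "continuous_map torus euclidean E" "inj_on E (topspace torus)"
    "\<And>x. E (torus_rel `` {x}) = (cis (2 * pi * fst x), cis (2 * pi * snd x))"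
    "E ` topspace torus = sphere 0 1 \<times> sphere 0 1"
proof -
  let ?e = "\<lambda>x. (cis (2 * pi * fst x), cis (2 * pi * snd x))"
  define E where "E C = ?e (SOME x. C = torus_rel `` {x})" for C
  have E: "E (torus_rel `` {x}) = ?e x" for x
  proof -
    have "torus_rel `` {x} = torus_rel `` {SOME y. torus_rel `` {x} = torus_rel `` {y}}"
      by (rule someI) (rule refl)
    then have "?e x = ?e (SOME y. torus_rel `` {x} = torus_rel `` {y})"
      unfolding torus_class_eq_iff[of x] cis_2pi_eq_iff prod.inject .
    then show ?thesis by (simp only: E_def)
  qed
  show ?thesis
  proof (rule that)
    show "continuous_map torus euclidean E"
      unfolding continuous_map_torus_iff E by (intro continuous_intros)
    show "inj_on E (topspace torus)"
      by (auto simp: inj_on_def topspace_torus E torus_class_eq_iff cis_2pi_eq_iff)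
    show "E ` topspace torus = sphere 0 1 \<times> sphere 0 1"
    proof (intro equalityI subsetI)
      fix z assume "z \<in> E ` topspace torus"
      then show "z \<in> sphere 0 1 \<times> sphere 0 1" by (auto simp: topspace_torus E)
    next
      fix z :: "complex \<times> complex" assume "z \<in> sphere 0 1 \<times> sphere 0 1"
      then have "norm (fst z) = 1" "norm (snd z) = 1" by (auto simp: mem_Times_iff)
      then obtain s t where "fst z = cis (2 * pi * s)" "snd z = cis (2 * pi * t)"
        using unit_complex_eq_cis_2pi by metis
      then have "z = (cis (2 * pi * s), cis (2 * pi * t))" by (simp add: prod_eq_iff)
      then have "z = E (torus_rel `` {(s, t)})" by (simp add: E)
      then show "z \<in> E ` topspace torus" by simp
    qed
  qed (rule E)
qed

lemma circle_embedding:
  obtains E :: "real set \<Rightarrow> complex"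
  where "continuous_map circle euclidean E" "inj_on E (topspace circle)"
    "\<And>x. E (circle_rel `` {x}) = cis (2 * pi * x)"
    "E ` topspace circle = sphere 0 1"
proof -
  let ?e = "\<lambda>x. cis (2 * pi * x)"
  define E where "E C = ?e (SOME x. C = circle_rel `` {x})" for C
  have E: "E (circle_rel `` {x}) = ?e x" for x
  proof -
    have "circle_rel `` {x} = circle_rel `` {SOME y. circle_rel `` {x} = circle_rel `` {y}}"
      by (rule someI) (rule refl)
    then have "?e x = ?e (SOME y. circle_rel `` {x} = circle_rel `` {y})"
      unfolding circle_class_eq_iff[of x] cis_2pi_eq_iff .
    then show ?thesis by (simp only: E_def)
  qed
  show ?thesis
  proof (rule that)
    show "continuous_map circle euclidean E"
      unfolding continuous_map_circle_iff E by (intro continuous_intros)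
    show "inj_on E (topspace circle)"
      by (auto simp: inj_on_def topspace_circle E circle_class_eq_iff cis_2pi_eq_iff)
    show "E ` topspace circle = sphere 0 1"
    proof (intro equalityI subsetI)
      fix z assume "z \<in> E ` topspace circle"
      then show "z \<in> sphere 0 1" by (auto simp: topspace_circle E)
    next
      fix z :: complex assume "z \<in> sphere 0 1"
      then obtain s where "z = cis (2 * pi * s)"
        using unit_complex_eq_cis_2pi[of z] by auto
      then have "z = E (circle_rel `` {s})" by (simp add: E)
      then show "z \<in> E ` topspace circle" by simp
    qed
  qed (rule E)
qed

lemma Hausdorff_space_torus: "Hausdorff_space torus"
proof -
  obtain E :: "(real \<times> real) set \<Rightarrow> complex \<times> complex"
    where "continuous_map torus euclidean E" "inj_on E (topspace torus)"
    using torus_embedding by metis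
  then show ?thesis
    using Hausdorff_space_injective_preimage[of euclidean torus E] by simp
qed

lemma torus_translation_class: "torus_translation \<alpha> (torus_rel `` {x}) = torus_rel `` {x + \<alpha>}"
  unfolding torus_translation_def
  by (rule induced_map_class[OF equiv_torus_rel]) (auto simp: torus_rel_def)

lemma circle_rotation_class: "circle_rotation \<alpha> (circle_rel `` {x}) = circle_rel `` {x + \<alpha>}"
  unfolding circle_rotation_def
  by (rule induced_map_class[OF equiv_circle_rel]) (auto simp: circle_rel_def)

section \<open>Degrees of nonvanishing functions on the torus\<close>

lemma continuous_exp_constant:
  fixes F :: "'a::real_normed_vector \<Rightarrow> complex"
  assumes cont: "continuous_on UNIV F" and "\<And>x. exp (F x) = exp w"
  obtains n :: int where "\<And>x. F x = w + 2 * pi * of_int n * \<i>"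
proof -
  have vals: "\<exists>n::int. F x = w + 2 * pi * of_int n * \<i>" for x
    using assms(2)[of x] unfolding exp_eq by (auto simp: algebra_simps)
  have "F constant_on UNIV"
  proof (rule continuous_discrete_range_constant[OF connected_UNIV cont])
    fix x :: 'a
    have "1 \<le> norm (F y - F x)" if "F y \<noteq> F x" for y
    proof -
      obtain m n :: int where mn: "F x = w + 2 * pi * of_int m * \<i>" "F y = w + 2 * pi * of_int n * \<i>"
        using vals by meson
      then have "F y - F x = of_real (2 * pi * of_int (n - m)) * \<i>" by (simp add: algebra_simps)
      then have "norm (F y - F x) = 2 * pi * \<bar>of_int (n - m)\<bar>"
        by (simp only: norm_mult norm_of_real norm_ii) (simp add: abs_mult)
      moreover have "n \<noteq> m" using mn that by auto
      then have "1 \<le> \<bar>real_of_int (n - m)\<bar>" by linarith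
      moreover have "1 \<le> 2 * pi" using pi_gt3 by simp
      ultimately show ?thesis
        using mult_mono[of 1 "2 * pi" 1 "\<bar>real_of_int (n - m)\<bar>"] by simp
    qed
    then show "\<exists>e>0. \<forall>y. y \<in> UNIV \<and> F y \<noteq> F x \<longrightarrow> e \<le> norm (F y - F x)"
      by (intro exI[of _ 1]) auto
  qed
  then obtain v where "\<And>x. F x = v" by (auto simp: constant_on_def)
  then show ?thesis using vals[of 0] that by metis
qed

text \<open>The two components of the degree are the winding numbers of \<open>h\<close> along the two generating loops,
read off from a logarithm of \<open>h\<close> on the universal cover.\<close>

definition has_degree :: "((real \<times> real) set \<Rightarrow> complex) \<Rightarrow> int \<times> int \<Rightarrow> bool" where
  "has_degree h d \<longleftrightarrow> (\<exists>\<theta>. continuous_on UNIV \<theta> \<and> (\<forall>x. h (torus_rel `` {x}) = exp (\<theta> x)) \<and>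
     (\<forall>x. \<theta> (x + (1, 0)) = \<theta> x + 2 * pi * of_int (fst d) * \<i>) \<and>
     (\<forall>x. \<theta> (x + (0, 1)) = \<theta> x + 2 * pi * of_int (snd d) * \<i>))"

text \<open>A period of the covering changes a logarithm by an integer multiple of \<open>2 pi \<i>\<close>, and by
connectedness by the same one at every point.\<close>

lemma has_degree_exists:
  assumes h: "continuous_map torus euclidean h" and nz: "\<And>C. C \<in> topspace torus \<Longrightarrow> h C \<noteq> 0"
  obtains d where "has_degree h d"
proof -
  obtain \<theta> where \<theta>: "continuous_on UNIV \<theta>" "\<And>x. h (torus_rel `` {x}) = exp (\<theta> x)"
    using continuous_logarithm_on_contractible[of UNIV "\<lambda>x. h (torus_rel `` {x})"] h nz
    by (auto simp: continuous_map_torus_iff)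
  have per: "\<exists>n::int. \<forall>x. \<theta> (x + e) = \<theta> x + 2 * pi * of_int n * \<i>"
    if e: "fst e \<in> \<int>" "snd e \<in> \<int>" for e
  proof -
    have "exp (\<theta> (x + e) - \<theta> x) = exp 0" for x
    proof -
      have "torus_rel `` {x + e} = torus_rel `` {x}" using e by (simp add: torus_class_eq_iff)
      then have "exp (\<theta> (x + e)) = exp (\<theta> x)" using \<theta>(2) by metis
      then show ?thesis by (simp add: exp_diff)
    qed
    moreover have "continuous_on UNIV (\<lambda>x. \<theta> (x + e) - \<theta> x)"
      by (intro continuous_intros continuous_on_compose2[OF \<theta>(1)] \<theta>(1)) auto
    ultimately obtain n :: int where "\<And>x. \<theta> (x + e) - \<theta> x = 0 + 2 * pi * of_int n * \<i>"
      using continuous_exp_constant[of "\<lambda>x. \<theta> (x + e) - \<theta> x" 0] by metis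
    then show ?thesis by (metis add.commute add.left_neutral diff_add_cancel)
  qed
  obtain m n :: int where "\<forall>x. \<theta> (x + (1, 0)) = \<theta> x + 2 * pi * of_int m * \<i>"
    "\<forall>x. \<theta> (x + (0, 1)) = \<theta> x + 2 * pi * of_int n * \<i>"
    using per[of "(1, 0)"] per[of "(0, 1)"] by auto
  then have "has_degree h (m, n)"
    unfolding has_degree_def using \<theta> by (intro exI[of _ \<theta>]) simp
  then show ?thesis by (rule that)
qed

lemma has_degree_mult:
  assumes "has_degree h d" "has_degree h' d'"
  shows "has_degree (\<lambda>C. h C * h' C) (d + d')"
proof -
  obtain \<theta> \<theta>' where "continuous_on UNIV \<theta>" "\<forall>x. h (torus_rel `` {x}) = exp (\<theta> x)"
    "\<forall>x. \<theta> (x + (1, 0)) = \<theta> x + 2 * pi * of_int (fst d) * \<i>"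
    "\<forall>x. \<theta> (x + (0, 1)) = \<theta> x + 2 * pi * of_int (snd d) * \<i>"
    and "continuous_on UNIV \<theta>'" "\<forall>x. h' (torus_rel `` {x}) = exp (\<theta>' x)"
    "\<forall>x. \<theta>' (x + (1, 0)) = \<theta>' x + 2 * pi * of_int (fst d') * \<i>"
    "\<forall>x. \<theta>' (x + (0, 1)) = \<theta>' x + 2 * pi * of_int (snd d') * \<i>"
    using assms unfolding has_degree_def by blast
  then show ?thesis
    unfolding has_degree_def
    by (intro exI[of _ "\<lambda>x. \<theta> x + \<theta>' x"]) (auto simp: exp_add algebra_simps intro: continuous_on_add)
qed

lemma has_degree_power_int:
  assumes "has_degree h d"
  shows "has_degree (\<lambda>C. h C powi k) (k * fst d, k * snd d)"
proof -
  obtain \<theta> where "continuous_on UNIV \<theta>" "\<forall>x. h (torus_rel `` {x}) = exp (\<theta> x)"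
    "\<forall>x. \<theta> (x + (1, 0)) = \<theta> x + 2 * pi * of_int (fst d) * \<i>"
    "\<forall>x. \<theta> (x + (0, 1)) = \<theta> x + 2 * pi * of_int (snd d) * \<i>"
    using assms unfolding has_degree_def by blast
  then show ?thesis
    unfolding has_degree_def
    by (intro exI[of _ "\<lambda>x. of_int k * \<theta> x"])
      (auto simp: exp_power_int algebra_simps intro!: continuous_intros)
qed

lemma has_degree_constant:
  assumes "has_degree h d" and const: "\<And>C D. \<lbrakk>C \<in> topspace torus; D \<in> topspace torus\<rbrakk> \<Longrightarrow> h C = h D"
  shows "d = (0, 0)"
proof -
  obtain \<theta> where \<theta>: "continuous_on UNIV \<theta>" "\<forall>x. h (torus_rel `` {x}) = exp (\<theta> x)"
    "\<forall>x. \<theta> (x + (1, 0)) = \<theta> x + 2 * pi * of_int (fst d) * \<i>"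
    "\<forall>x. \<theta> (x + (0, 1)) = \<theta> x + 2 * pi * of_int (snd d) * \<i>"
    using assms unfolding has_degree_def by blast
  have "exp (\<theta> x) = exp (\<theta> 0)" for x
    using const[of "torus_rel `` {x}" "torus_rel `` {0}"] \<theta>(2) by simp
  from continuous_exp_constant[OF \<theta>(1) this]
  obtain n :: int where n: "\<And>x. \<theta> x = \<theta> 0 + 2 * pi * of_int n * \<i>" by metis
  then have "\<theta> x = \<theta> y" for x y by metis
  then have "\<theta> 0 = \<theta> 0 + 2 * pi * of_int (fst d) * \<i>" "\<theta> 0 = \<theta> 0 + 2 * pi * of_int (snd d) * \<i>"
    using \<theta>(3,4) by metis+
  then show ?thesis by (simp add: prod_eq_iff)
qed

lemma degree_zero_logarithm:
  assumes "has_degree h (0, 0)"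
  obtains k where "continuous_map torus euclidean k" "\<And>C. C \<in> topspace torus \<Longrightarrow> h C = exp (k C)"
proof -
  obtain \<theta> where \<theta>: "continuous_on UNIV \<theta>" "\<And>x. h (torus_rel `` {x}) = exp (\<theta> x)"
    "\<And>x. \<theta> (x + (1, 0)) = \<theta> x" "\<And>x. \<theta> (x + (0, 1)) = \<theta> x"
    using assms unfolding has_degree_def by auto
  have p1: "\<theta> (x + (of_int m, 0)) = \<theta> x" for x and m :: int
  proof (induction m rule: int_induct[of _ 0])
    case base
    show ?case by (simp flip: zero_prod_def)
  next
    case (step1 i)
    then show ?case using \<theta>(3)[of "x + (of_int i, 0)"] by (simp add: algebra_simps)
  next
    case (step2 i)
    then show ?case using \<theta>(3)[of "x + (of_int (i - 1), 0)"] by (simp add: algebra_simps)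
  qed
  have p2: "\<theta> (x + (0, of_int m)) = \<theta> x" for x and m :: int
  proof (induction m rule: int_induct[of _ 0])
    case base
    show ?case by (simp flip: zero_prod_def)
  next
    case (step1 i)
    then show ?case using \<theta>(4)[of "x + (0, of_int i)"] by (simp add: algebra_simps)
  next
    case (step2 i)
    then show ?case using \<theta>(4)[of "x + (0, of_int (i - 1))"] by (simp add: algebra_simps)
  qed
  have const: "\<theta> x = \<theta> y" if xy: "torus_rel `` {x} = torus_rel `` {y}" for x y
  proof -
    obtain m n :: int where "fst x - fst y = of_int m" "snd x - snd y = of_int n"
      using xy unfolding torus_class_eq_iff by (auto elim!: Ints_cases)
    then have "x = y + (of_int m, 0) + (0, of_int n)" by (simp add: prod_eq_iff)
    then show ?thesis using p1 p2 by simp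
  qed
  have cont: "continuous_map euclidean euclidean \<theta>" using \<theta>(1) by simp
  obtain k where k: "continuous_map torus euclidean k"
    "\<And>x. x \<in> topspace euclidean \<Longrightarrow> k (torus_rel `` {x}) = \<theta> x"
    by (rule quotient_map_lift_exists[OF quotient_map_quotient_topology[of euclidean torus_rel, folded torus_def] cont])
      (use const in blast)+
  show ?thesis
    using \<theta>(2) k by (intro that[OF k(1)]) (auto simp: topspace_torus)
qed

text \<open>Let \<open>k\<close> be a logarithm of \<open>h\<close> on the torus. By connectedness \<open>k \<circ> f - k\<close> is a constant, and
since \<open>k\<close> is bounded along orbits this constant is \<open>0\<close>. Thus \<open>k\<close> is invariant, and invariant
functions are constant. This is where minimality turns the eigenfunctions, up to constants,
into a subgroup of \<open>\<int>\<^sup>2\<close>.\<close>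

lemma degree_zero_eigenfunction_constant:
  assumes f: "homeomorphic_map torus torus f"
    and minim: "minimal_system (mef_space torus f) (mef_map torus f)"
    and h: "eigenfunction torus f c h" and deg: "has_degree h (0, 0)"
    and CD: "C \<in> topspace torus" "D \<in> topspace torus"
  shows "h C = h D"
proof -
  obtain k where k: "continuous_map torus euclidean k" "\<And>C. C \<in> topspace torus \<Longrightarrow> h C = exp (k C)"
    using degree_zero_logarithm[OF deg] by metis
  have fc: "continuous_map torus torus f" and fin: "\<And>C. C \<in> topspace torus \<Longrightarrow> f C \<in> topspace torus"
    using f by (auto simp: homeomorphic_eq_everything_map)
  have kf: "continuous_map torus euclidean (\<lambda>C. k (f C) - k C)"
    by (intro continuous_intros k(1) continuous_map_compose[OF fc k(1), unfolded o_def])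
  define F where "F x = k (f (torus_rel `` {x})) - k (torus_rel `` {x})" for x
  have expF: "exp (F x) = c" for x
  proof -
    have "h (f (torus_rel `` {x})) = c * h (torus_rel `` {x})" using h by (simp add: eigenfunction_def)
    then show ?thesis using k(2) fin by (simp add: F_def exp_diff)
  qed
  have "continuous_on UNIV F"
    using kf unfolding continuous_map_torus_iff F_def .
  then obtain n :: int where "\<And>x. F x = F 0 + 2 * pi * of_int n * \<i>"
    using continuous_exp_constant[of F "F 0"] expF by metis
  then have Fconst: "F x = F 0" for x by (metis add_cancel_left_right)
  then have shift: "k (f C) = k C + F 0" if C: "C \<in> topspace torus" for C
  proof -
    obtain x where x: "C = torus_rel `` {x}" using C by (auto simp only: topspace_torus)
    have "k (f C) - k C = F 0" using Fconst[of x] by (simp add: x F_def)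
    then show ?thesis by (simp add: algebra_simps)
  qed
  have iter: "(f ^^ j) C \<in> topspace torus \<and> k ((f ^^ j) C) = k C + of_nat j * F 0" for j
    using CD(1) by (induction j) (auto simp: fin shift algebra_simps)
  obtain B where B: "\<And>C. C \<in> topspace torus \<Longrightarrow> norm (k C) \<le> B"
    using continuous_map_compact_bounded[OF compact_space_torus k(1)] by metis
  have bound: "real j * norm (F 0) \<le> 2 * B" for j
  proof -
    have "of_nat j * F 0 = k ((f ^^ j) C) - k C" using iter[of j] by simp
    then have "real j * norm (F 0) = norm (k ((f ^^ j) C) - k C)"
      by (metis norm_mult norm_of_nat)
    also have "\<dots> \<le> norm (k ((f ^^ j) C)) + norm (k C)" by (rule norm_triangle_ineq4)
    also have "\<dots> \<le> 2 * B" using B iter[of j] CD(1) by (smt (verit))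
    finally show ?thesis .
  qed
  have "F 0 = 0"
  proof (rule ccontr)
    assume "F 0 \<noteq> 0"
    then obtain j :: nat where "2 * B < real j * norm (F 0)"
      using ex_less_of_nat_mult[of "norm (F 0)" "2 * B"] by auto
    then show False using bound[of j] by simp
  qed
  then have "eigenfunction torus f 1 k"
    using k(1) shift by (simp add: eigenfunction_def)
  from minimal_mef_invariant_constant[OF compact_space_torus Hausdorff_space_torus f minim this CD]
  show ?thesis using k(2) CD by simp
qed

section \<open>Subgroups of the integer plane\<close>

lemma int_subgroup_cyclic:
  fixes S :: "int set"
  assumes zero: "0 \<in> S" and diff: "\<And>a b. \<lbrakk>a \<in> S; b \<in> S\<rbrakk> \<Longrightarrow> a - b \<in> S"
  obtains a where "a \<in> S" "\<And>b. b \<in> S \<Longrightarrow> \<exists>k. b = k * a"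
proof (cases "S \<subseteq> {0}")
  case True
  then show ?thesis using zero by (intro that[of 0]) auto
next
  case False
  have neg: "- a \<in> S" if "a \<in> S" for a using diff[OF zero that] by simp
  have add: "a + b \<in> S" if "a \<in> S" "b \<in> S" for a b using diff[OF that(1) neg[OF that(2)]] by simp
  obtain s where s: "s \<in> S" "s \<noteq> 0" using False by auto
  define P where "P = (\<lambda>n::nat. n > 0 \<and> int n \<in> S)"
  have "P (nat \<bar>s\<bar>)" using s neg[of s] by (cases "s > 0") (auto simp: P_def)
  define n where "n = (LEAST n. P n)"
  have n: "P n" unfolding n_def by (rule LeastI) fact
  have mult: "k * int n \<in> S" for k :: int
  proof (induction k rule: int_induct[of _ 0])
    case base
    then show ?case using zero by simp
  next
    case (step1 i)
    then show ?case using add[of "i * int n" "int n"] n by (simp add: P_def algebra_simps)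
  next
    case (step2 i)
    then show ?case using diff[of "i * int n" "int n"] n by (simp add: P_def algebra_simps)
  qed
  have "b = (b div int n) * int n" if b: "b \<in> S" for b
  proof -
    have "b mod int n = b - (b div int n) * int n" by (simp add: minus_div_mult_eq_mod)
    then have "b mod int n \<in> S" using diff[OF b mult] by simp
    moreover have "0 \<le> b mod int n" "b mod int n < int n" using n by (auto simp: P_def)
    moreover have "\<not> P (nat (b mod int n))"
      using not_less_Least[of "nat (b mod int n)" P] \<open>b mod int n < int n\<close> \<open>0 \<le> b mod int n\<close>
      by (simp add: n_def nat_less_iff)
    ultimately have "b mod int n = 0" by (auto simp: P_def)
    then show ?thesis by (metis add.right_neutral div_mult_mod_eq)
  qed
  moreover have "int n \<in> S" using n by (simp add: P_def)
  ultimately show ?thesis using that by metis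
qed

text \<open>One generator spans the part of \<open>D\<close> on the first axis; the other is a point of \<open>D\<close> over a
generator of the projection to the second axis.\<close>

lemma int_plane_subgroup_basis:
  fixes D :: "(int \<times> int) set"
  assumes zero: "(0, 0) \<in> D"
    and diff: "\<And>d e. \<lbrakk>d \<in> D; e \<in> D\<rbrakk> \<Longrightarrow> d - e \<in> D"
  obtains "D = {(0, 0)}"
  | u where "u \<in> D" "u \<noteq> (0, 0)" "\<And>d. d \<in> D \<Longrightarrow> \<exists>k. d = (k * fst u, k * snd u)"
  | u v where "u \<in> D" "v \<in> D" "fst u * snd v - snd u * fst v \<noteq> 0"
      "\<And>d. d \<in> D \<Longrightarrow> \<exists>k l. d = (k * fst u + l * fst v, k * snd u + l * snd v)"
proof -
  have neg: "- d \<in> D" if "d \<in> D" for d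
    using diff[OF zero that] by (cases d) simp
  have add: "d + e \<in> D" if "d \<in> D" "e \<in> D" for d e using diff[OF that(1) neg[OF that(2)]] by simp
  obtain b where b: "b \<in> snd ` D" "\<And>b'. b' \<in> snd ` D \<Longrightarrow> \<exists>k. b' = k * b"
    using int_subgroup_cyclic[of "snd ` D"] zero diff
    by (smt (verit) image_iff snd_conv snd_diff)
  obtain a where a: "(a, 0) \<in> D" "\<And>a'. (a', 0) \<in> D \<Longrightarrow> \<exists>k. a' = k * a"
  proof (rule int_subgroup_cyclic[of "{a. (a, 0) \<in> D}"])
    show "x - y \<in> {a. (a, 0) \<in> D}" if "x \<in> {a. (a, 0) \<in> D}" "y \<in> {a. (a, 0) \<in> D}" for x y
      using diff[of "(x, 0)" "(y, 0)"] that by simp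
  qed (use zero in auto)
  obtain c where c: "(c, b) \<in> D" using b(1) by auto
  have mult: "(k * c, k * b) \<in> D" for k
  proof (induction k rule: int_induct[of _ 0])
    case base
    then show ?case using zero by simp
  next
    case (step1 i)
    then show ?case using add[OF _ c] by (simp add: algebra_simps) (metis add.commute add_Pair)
  next
    case (step2 i)
    then show ?case using diff[OF _ c] by (fastforce simp: algebra_simps)
  qed
  have rep: "\<exists>k l. d = (k * a + l * c, l * b)" if d: "d \<in> D" for d
  proof -
    obtain l where l: "snd d = l * b" using b(2) d by auto
    have "(fst d - l * c, 0) \<in> D"
      using diff[OF d mult[of l]] l by (cases d) simp
    then obtain k where "fst d - l * c = k * a" using a(2) by blast
    then show ?thesis using l by (intro exI[of _ k] exI[of _ l]) (simp add: prod_eq_iff)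
  qed
  show ?thesis
  proof (cases "a = 0")
    case True
    show ?thesis
    proof (cases "(c, b) = (0, 0)")
      case True
      then have "D = {(0, 0)}" using rep \<open>a = 0\<close> zero by fastforce
      then show ?thesis by (rule that(1))
    next
      case False
      show ?thesis
        by (rule that(2)[OF c False]) (use rep \<open>a = 0\<close> in fastforce)
    qed
  next
    case a0: False
    show ?thesis
    proof (cases "b = 0")
      case True
      then obtain k where "c = k * a" using a(2) c by auto
      then have "\<exists>k. d = (k * a, k * 0)" if "d \<in> D" for d
      proof -
        obtain i l where "d = (i * a + l * c, l * b)" using rep[OF \<open>d \<in> D\<close>] by blast
        then have "d = ((i + l * k) * a, (i + l * k) * 0)"
          using \<open>c = k * a\<close> True by (simp add: algebra_simps)
        then show ?thesis by blast
      qed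
      then show ?thesis using a0 by (intro that(2)[OF a(1)]) auto
    next
      case False
      show ?thesis
        by (rule that(3)[OF a(1) c]) (use rep a0 False in auto)
    qed
  qed
qed

section \<open>Independent eigenvalues and density of orbits\<close>

lemma cis_integer_relation:
  fixes P Q R :: int
  assumes indep: "\<And>m n. cis (2 * pi * \<alpha>) powi m * cis (2 * pi * \<beta>) powi n = 1 \<Longrightarrow> m = 0 \<and> n = 0"
    and rel: "of_int P + of_int Q * \<alpha> + of_int R * \<beta> = 0"
  shows "P = 0 \<and> Q = 0 \<and> R = 0"
proof -
  have "cis (2 * pi * \<alpha>) powi Q * cis (2 * pi * \<beta>) powi R = cis (2 * pi * (of_int Q * \<alpha> + of_int R * \<beta>))"
    by (simp add: cis_power_int cis_mult algebra_simps)
  also have "of_int Q * \<alpha> + of_int R * \<beta> = of_int (- P)" using rel by simp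
  also have "cis (2 * pi * of_int (- P)) = 1" by (rule cis_multiple_2pi) simp
  finally have "Q = 0 \<and> R = 0" by (rule indep)
  then show ?thesis using rel by simp
qed

lemma rationally_independent_of_cis:
  assumes indep: "\<And>m n. cis (2 * pi * \<alpha>) powi m * cis (2 * pi * \<beta>) powi n = 1 \<Longrightarrow> m = 0 \<and> n = 0"
  shows "rationally_independent_with_1 \<alpha> \<beta>"
  unfolding rationally_independent_with_1_def
proof (intro allI impI)
  fix p q r :: rat
  assume rel: "of_rat p + of_rat q * \<alpha> + of_rat r * \<beta> = 0"
  obtain p1 p2 where p: "p = of_int p1 / of_int p2" "p2 > 0" by (metis Rat.Rat_cases Fract_of_int_quotient)
  obtain q1 q2 where q: "q = of_int q1 / of_int q2" "q2 > 0" by (metis Rat.Rat_cases Fract_of_int_quotient)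
  obtain r1 r2 where r: "r = of_int r1 / of_int r2" "r2 > 0" by (metis Rat.Rat_cases Fract_of_int_quotient)
  have "of_int (p1 * q2 * r2) + of_int (q1 * p2 * r2) * \<alpha> + of_int (r1 * p2 * q2) * \<beta>
      = of_int (p2 * q2 * r2) * (of_rat p + of_rat q * \<alpha> + of_rat r * \<beta>)"
    using p(2) q(2) r(2) by (simp add: p(1) q(1) r(1) of_rat_divide field_simps)
  then have "of_int (p1 * q2 * r2) + of_int (q1 * p2 * r2) * \<alpha> + of_int (r1 * p2 * q2) * \<beta> = 0"
    using rel by simp
  from cis_integer_relation[OF indep this] show "p = 0 \<and> q = 0 \<and> r = 0"
    using p q r by simp
qed

lemma irrational_of_cis:
  assumes indep: "\<And>m. cis (2 * pi * \<alpha>) powi m = 1 \<Longrightarrow> m = 0"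
  shows "\<alpha> \<notin> \<rat>"
proof
  assume "\<alpha> \<in> \<rat>"
  then obtain a b :: int where ab: "\<alpha> = of_int a / of_int b" "b > 0" by (rule Rats_cases')
  then have "of_int b * (2 * pi * \<alpha>) = 2 * pi * of_int a" by simp
  then have "cis (2 * pi * \<alpha>) powi b = cis (2 * pi * of_int a)"
    by (simp only: cis_power_int)
  also have "\<dots> = 1" by (rule cis_multiple_2pi) simp
  finally have "cis (2 * pi * \<alpha>) powi b = 1" .
  then show False using indep ab(2) by blast
qed

lemma cis_2pi_power_int: "cis (2 * pi * x) powi k = cis (2 * pi * (of_int k * x - of_int j))"
proof -
  have "cis (2 * pi * x) powi k = cis (2 * pi * (of_int k * x))"
    by (simp add: cis_power_int mult_ac)
  then show ?thesis by (simp add: cis_2pi_eq_iff)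
qed

lemma isCont_cis_2pi: "isCont (\<lambda>x. cis (2 * pi * x)) s"
proof -
  have "continuous_on UNIV (\<lambda>x. cis (2 * pi * x))" by (intro continuous_intros)
  then show ?thesis by (simp add: continuous_on_eq_continuous_at)
qed

lemma dense_powers_torus:
  fixes c1 c2 w1 w2 :: complex
  assumes unit: "norm c1 = 1" "norm c2 = 1" "norm w1 = 1" "norm w2 = 1"
    and indep: "\<And>m n. c1 powi m * c2 powi n = 1 \<Longrightarrow> m = 0 \<and> n = 0" and "e > 0"
  obtains n :: int where "norm (c1 powi n - w1) < e" "norm (c2 powi n - w2) < e"
proof -
  obtain \<alpha> \<beta> s t where ab: "c1 = cis (2 * pi * \<alpha>)" "c2 = cis (2 * pi * \<beta>)"
    "w1 = cis (2 * pi * s)" "w2 = cis (2 * pi * t)"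
    using unit unit_complex_eq_cis_2pi by metis
  have rel: "P = 0 \<and> Q = 0 \<and> R = 0" if "of_int P + of_int Q * \<alpha> + of_int R * \<beta> = 0" for P Q R :: int
    using cis_integer_relation[of \<alpha> \<beta>, OF _ that] indep unfolding ab by blast
  have neq: "\<alpha> \<noteq> \<beta>" "\<alpha> \<noteq> 1" "\<beta> \<noteq> 1"
    using rel[of 0 1 "-1"] rel[of "-1" 1 0] rel[of "-1" 0 1] by auto
  have "isCont (\<lambda>x. cis (2 * pi * x)) s" "isCont (\<lambda>x. cis (2 * pi * x)) t"
    by (rule isCont_cis_2pi)+
  then obtain d1 d2 where d: "d1 > 0" "\<And>x. \<bar>x - s\<bar> < d1 \<Longrightarrow> norm (cis (2 * pi * x) - w1) < e"
    "d2 > 0" "\<And>x. \<bar>x - t\<bar> < d2 \<Longrightarrow> norm (cis (2 * pi * x) - w2) < e"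
    using \<open>e > 0\<close> unfolding continuous_at_eps_delta ab by (metis dist_norm real_norm_def)
  define \<theta> where "\<theta> i = (if i = 0 then \<alpha> else if i = 1 then \<beta> else 1)" for i :: nat
  define a where "a i = (if i = 0 then s else t)" for i :: nat
  have im: "\<theta> ` {..2} = {\<alpha>, \<beta>, 1}"
    by (auto simp: \<theta>_def numeral_2_eq_2 atMost_Suc)
  interpret M: module "\<lambda>r x. real_of_int r * x"
    by (simp add: Modules.module.intro distrib_left mult.commute)
  have "M.independent (\<theta> ` {..2})"
    unfolding im
  proof
    assume "M.dependent {\<alpha>, \<beta>, 1}"
    then obtain u v where v: "v \<in> {\<alpha>, \<beta>, 1}" "u v \<noteq> 0"
      and sum: "(\<Sum>v\<in>{\<alpha>, \<beta>, 1}. real_of_int (u v) * v) = 0"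
      by (subst (asm) M.dependent_finite) auto
    have "of_int (u 1) + of_int (u \<alpha>) * \<alpha> + of_int (u \<beta>) * \<beta> = 0"
      using sum neq by simp
    from rel[OF this] v show False by auto
  qed
  moreover have "inj_on \<theta> {..2}"
    using neq by (auto simp: inj_on_def \<theta>_def numeral_2_eq_2 le_Suc_eq)
  moreover have "\<theta> 2 = 1" by (simp add: \<theta>_def)
  moreover have "min d1 d2 > 0" using d by simp
  ultimately obtain k m where km: "\<And>i. i < 2 \<Longrightarrow> \<bar>of_int k * \<theta> i - of_int (m i) - a i\<bar> < min d1 d2"
    using Kronecker_thm_2[of \<theta> 2 "min d1 d2" a] by metis
  show ?thesis
  proof (rule that[of k])
    show "norm (c1 powi k - w1) < e"
      unfolding ab(1) cis_2pi_power_int[of \<alpha> k "m 0"] using km[of 0] by (intro d(2)) (simp add: \<theta>_def a_def)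
    show "norm (c2 powi k - w2) < e"
      unfolding ab(2) cis_2pi_power_int[of \<beta> k "m 1"] using km[of 1] by (intro d(4)) (simp add: \<theta>_def a_def)
  qed
qed

lemma dense_powers_circle:
  fixes c w :: complex
  assumes unit: "norm c = 1" "norm w = 1"
    and indep: "\<And>m. c powi m = 1 \<Longrightarrow> m = 0" and "e > 0"
  obtains n :: int where "norm (c powi n - w) < e"
proof -
  obtain \<alpha> s where ab: "c = cis (2 * pi * \<alpha>)" "w = cis (2 * pi * s)"
    using unit unit_complex_eq_cis_2pi by metis
  have "\<alpha> \<notin> \<rat>"
    using irrational_of_cis[of \<alpha>] indep unfolding ab by blast
  have "isCont (\<lambda>x. cis (2 * pi * x)) s"
    by (rule isCont_cis_2pi)
  then obtain d where d: "d > 0" "\<And>x. \<bar>x - s\<bar> < d \<Longrightarrow> norm (cis (2 * pi * x) - w) < e"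
    using \<open>e > 0\<close> unfolding continuous_at_eps_delta ab by (metis dist_norm real_norm_def)
  obtain j k where jk: "\<bar>of_int k * \<alpha> - of_int j - s\<bar> < d"
    using sequence_of_fractional_parts_is_dense[OF \<open>\<alpha> \<notin> \<rat>\<close> d(1)] by metis
  have "c powi k = cis (2 * pi * (of_int k * \<alpha> - of_int j))"
    unfolding ab by (rule cis_2pi_power_int)
  then show ?thesis using d(2)[OF jk] that by metis
qed

text \<open>Both systems are compared inside \<open>Z\<close>, where they become the restriction of one and the same map
\<open>T\<close> to one and the same compact set. For a nontrivial factor \<open>Z\<close> is the complex plane
or its square, and \<open>T\<close> multiplies by eigenvalues.\<close>

lemma conjugate_systems_via_embeddings:
  assumes comp: "compact_space Y" "compact_space Y'" and haus: "Hausdorff_space Z"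
    and \<Phi>: "continuous_map Y Z \<Phi>" "inj_on \<Phi> (topspace Y)"
    and E: "continuous_map Y' Z E" "inj_on E (topspace Y')"
    and im: "\<Phi> ` topspace Y = E ` topspace Y'"
    and g: "\<And>y. y \<in> topspace Y \<Longrightarrow> g y \<in> topspace Y \<and> \<Phi> (g y) = T (\<Phi> y)"
    and g': "\<And>y. y \<in> topspace Y' \<Longrightarrow> g' y \<in> topspace Y' \<and> E (g' y) = T (E y)"
  shows "conjugate_systems Y g Y' g'"
proof -
  let ?S = "subtopology Z (E ` topspace Y')"
  have S: "topspace ?S = E ` topspace Y'"
    using E(1) by (auto simp: continuous_map_def)
  have h1: "homeomorphic_map Y ?S \<Phi>"
    using \<Phi> comp(1) haus im S
    by (intro continuous_imp_homeomorphic_map) (auto simp: continuous_map_in_subtopology Hausdorff_space_subtopology)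
  have "homeomorphic_map Y' ?S E"
    using E comp(2) haus S
    by (intro continuous_imp_homeomorphic_map) (auto simp: continuous_map_in_subtopology Hausdorff_space_subtopology)
  then obtain E' where "homeomorphic_maps Y' ?S E E'"
    using homeomorphic_map_maps by blast
  then have h2: "homeomorphic_map ?S Y' E'" and E': "\<And>y. y \<in> topspace Y' \<Longrightarrow> E' (E y) = y"
    by (auto simp: homeomorphic_maps_map)
  have "E' (\<Phi> (g y)) = g' (E' (\<Phi> y))" if y: "y \<in> topspace Y" for y
  proof -
    obtain y' where y': "y' \<in> topspace Y'" "\<Phi> y = E y'" using im y by blast
    then have "\<Phi> (g y) = E (g' y')" using g[OF y] g'[OF y'(1)] by simp
    then show ?thesis using E'[of "g' y'"] E'[OF y'(1)] y' g'[OF y'(1)] by simp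
  qed
  then show ?thesis
    unfolding conjugate_systems_def
    using homeomorphic_map_compose[OF h1 h2] by (intro exI[of _ "E' \<circ> \<Phi>"]) simp
qed

section \<open>Maximal equicontinuous factors of torus homeomorphisms\<close>

locale torus_minimal_mef =
  fixes f :: "(real \<times> real) set \<Rightarrow> (real \<times> real) set"
  assumes homeo: "homeomorphic_map torus torus f"
    and minim: "minimal_system (mef_space torus f) (mef_map torus f)"
begin

text \<open>The explicit form of the maximal equicontinuous factor: \<open>g\<close> acting on \<open>Y\<close>.\<close>

abbreviation "S \<equiv> eigenfunction_relation torus f"
abbreviation "Y \<equiv> quotient_topology torus S"
abbreviation "g \<equiv> induced_map S f"

definition unit_eigenfunction :: "complex \<Rightarrow> ((real \<times> real) set \<Rightarrow> complex) \<Rightarrow> bool" where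
  "unit_eigenfunction c h \<longleftrightarrow> eigenfunction torus f c h \<and> (\<forall>C\<in>topspace torus. norm (h C) = 1)"

definition degrees :: "(int \<times> int) set" where
  "degrees = {d. \<exists>c h. unit_eigenfunction c h \<and> has_degree h d}"

lemma mef_eq: "mef_space torus f = Y" "mef_map torus f = g"
  by (simp_all add: mef_space_def mef_map_def
      equicontinuous_structure_relation_eq[OF compact_space_torus Hausdorff_space_torus homeo])

lemma bij_f: "bij_betw f (topspace torus) (topspace torus)"
  using homeo by (simp add: bij_betw_def homeomorphic_eq_everything_map)

lemma closed_invariant_equiv_S: "closed_invariant_equiv torus f S"
  by (rule closed_invariant_equiv_eigenfunction_relation[OF bij_f])

lemma equiv_S: "equiv (topspace torus) S"
  using closed_invariant_equiv_S by (simp add: closed_invariant_equiv_def)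

lemma bij_g: "bij_betw g (topspace Y) (topspace Y)"
  by (rule closed_invariant_equiv_bij_betw[OF closed_invariant_equiv_S bij_f])

lemma compact_Y: "compact_space Y"
  using quotient_topology_compact_normal_Hausdorff(1)[OF compact_space_torus Hausdorff_space_torus]
    closed_invariant_equiv_S by (simp add: closed_invariant_equiv_def)

lemma Y_nonempty: "S `` {torus_rel `` {0}} \<in> topspace Y"
  by (simp add: quotientI)

text \<open>The modulus of an eigenfunction is invariant, hence constant, and a nonzero constant can be
scaled to one.\<close>

lemma unit_eigenfunction_normalise:
  assumes h: "eigenfunction torus f c h" and C0: "C0 \<in> topspace torus" "h C0 \<noteq> 0"
  obtains r where "r \<noteq> 0" "unit_eigenfunction c (\<lambda>C. r * h C)"
proof -
  have hc: "continuous_map torus euclidean h" using h by (simp add: eigenfunction_def)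
  then have "continuous_map torus euclidean (\<lambda>C. complex_of_real (norm (h C)))"
    unfolding continuous_map_torus_iff by (intro continuous_intros)
  then have E: "eigenfunction torus f 1 (\<lambda>C. complex_of_real (norm (h C)))"
    using h by (simp add: eigenfunction_def norm_mult)
  have nrm: "norm (h C) = norm (h C0)" if "C \<in> topspace torus" for C
    using minimal_mef_invariant_constant[OF compact_space_torus Hausdorff_space_torus homeo minim E that C0(1)]
    by simp
  define r where "r = complex_of_real (1 / norm (h C0))"
  have r0: "r \<noteq> 0" using C0(2) by (simp add: r_def)
  have "continuous_map torus euclidean (\<lambda>C. r * h C)"
    using hc unfolding continuous_map_torus_iff by (intro continuous_intros)
  moreover have "norm (r * h C) = 1" if "C \<in> topspace torus" for C
    using nrm[OF that] C0(2) by (simp add: r_def norm_mult norm_divide)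
  ultimately have "unit_eigenfunction c (\<lambda>C. r * h C)"
    using h by (simp add: unit_eigenfunction_def eigenfunction_def)
  with r0 show ?thesis by (rule that)
qed

lemma unit_eigenfunction_mult:
  assumes "unit_eigenfunction c h" "unit_eigenfunction c' h'"
  shows "unit_eigenfunction (c * c') (\<lambda>C. h C * h' C)"
  using assms unfolding unit_eigenfunction_def eigenfunction_def continuous_map_torus_iff
  by (auto simp: norm_mult intro: continuous_on_mult)

lemma unit_eigenfunction_nonzero:
  "unit_eigenfunction c h \<Longrightarrow> C \<in> topspace torus \<Longrightarrow> h C \<noteq> 0"
  by (auto simp: unit_eigenfunction_def)

lemma unit_eigenfunction_power_int:
  assumes h: "unit_eigenfunction c h"
  shows "unit_eigenfunction (c powi k) (\<lambda>C. h C powi k)"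
proof -
  have "continuous_on UNIV (\<lambda>x. h (torus_rel `` {x}) powi k)"
    using h unit_eigenfunction_nonzero[OF h]
    by (intro continuous_on_power_int)
      (auto simp: unit_eigenfunction_def eigenfunction_def continuous_map_torus_iff)
  then show ?thesis
    using h unfolding unit_eigenfunction_def eigenfunction_def continuous_map_torus_iff
    by (auto simp: norm_power_int power_int_mult_distrib)
qed

lemma unit_eigenfunction_one: "unit_eigenfunction 1 (\<lambda>_. 1)"
  by (simp add: unit_eigenfunction_def eigenfunction_def)

lemma unit_eigenfunction_degree:
  assumes "unit_eigenfunction c h"
  obtains d where "has_degree h d"
  using has_degree_exists[of h] unit_eigenfunction_nonzero[OF assms] assms
  by (auto simp: unit_eigenfunction_def eigenfunction_def)

text \<open>The quotient of two eigenfunctions of equal degree is an eigenfunction of degree zero. So a unit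
eigenfunction is determined by its degree up to a constant factor, and separates the same points as
any other one of that degree.\<close>

lemma same_degree_proportional:
  assumes h: "unit_eigenfunction c h" "has_degree h d"
    and h': "unit_eigenfunction c' h'" "has_degree h' d"
    and CD: "C \<in> topspace torus" "D \<in> topspace torus" and eq: "h C = h D"
  shows "h' C = h' D"
proof -
  have "unit_eigenfunction (c' * c powi (-1)) (\<lambda>C. h' C * h C powi (-1))"
    by (intro unit_eigenfunction_mult unit_eigenfunction_power_int h h')
  then have "eigenfunction torus f (c' * c powi (-1)) (\<lambda>C. h' C * h C powi (-1))"
    by (simp add: unit_eigenfunction_def)
  moreover have "has_degree (\<lambda>C. h' C * h C powi (-1)) (0, 0)"
    using has_degree_mult[OF h'(2) has_degree_power_int[OF h(2), of "-1"]] by (cases d) simp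
  ultimately have "h' C * h C powi (-1) = h' D * h D powi (-1)"
    by (rule degree_zero_eigenfunction_constant[OF homeo minim _ _ CD])
  moreover have "h D powi (-1) \<noteq> 0" using unit_eigenfunction_nonzero[OF h(1) CD(2)] by simp
  ultimately show ?thesis unfolding eq by simp
qed

lemma degree_zero: "(0, 0) \<in> degrees"
proof -
  obtain d where "has_degree (\<lambda>_. 1) d" using unit_eigenfunction_degree[OF unit_eigenfunction_one] .
  then show ?thesis
    using has_degree_constant[of "\<lambda>_. 1" d] unit_eigenfunction_one by (auto simp: degrees_def)
qed

lemma degrees_diff:
  assumes "d \<in> degrees" "e \<in> degrees"
  shows "d - e \<in> degrees"
proof -
  obtain c h c' h' where h: "unit_eigenfunction c h" "has_degree h d"
    and h': "unit_eigenfunction c' h'" "has_degree h' e"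
    using assms unfolding degrees_def by auto
  have "unit_eigenfunction (c * c' powi (-1)) (\<lambda>C. h C * h' C powi (-1))"
    by (intro unit_eigenfunction_mult unit_eigenfunction_power_int h h')
  moreover have "has_degree (\<lambda>C. h C * h' C powi (-1)) (d - e)"
    using has_degree_mult[OF h(2) has_degree_power_int[OF h'(2), of "-1"]] by (cases d, cases e) simp
  ultimately show ?thesis by (auto simp: degrees_def)
qed

lemma S_iff_unit_eigenfunctions:
  "(C, D) \<in> S \<longleftrightarrow> C \<in> topspace torus \<and> D \<in> topspace torus \<and>
     (\<forall>c h d. unit_eigenfunction c h \<and> has_degree h d \<longrightarrow> h C = h D)" (is "?L \<longleftrightarrow> ?R")
proof
  assume ?L
  then show ?R unfolding eigenfunction_relation_iff unit_eigenfunction_def by blast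
next
  assume R: ?R
  have "h C = h D" if h: "eigenfunction torus f c h" for c h
  proof (rule ccontr)
    assume ne: "h C \<noteq> h D"
    \<comment> \<open>A function that separates two points is nonzero somewhere, so it can be normalised.\<close>
    then obtain C0 where C0: "C0 \<in> topspace torus" "h C0 \<noteq> 0" using R by metis
    obtain r where r: "r \<noteq> 0" "unit_eigenfunction c (\<lambda>C. r * h C)"
      using unit_eigenfunction_normalise[OF h C0] .
    obtain d where "has_degree (\<lambda>C. r * h C) d" using unit_eigenfunction_degree[OF r(2)] .
    then have "r * h C = r * h D" using R r(2) by blast
    then show False using r(1) ne by simp
  qed
  then show ?L using R by (simp add: eigenfunction_relation_iff)
qed

text \<open>Applied to a monomial in generating eigenfunctions, this turns a multiplicative relation between
the eigenvalues into a linear relation between the degrees.\<close>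

lemma unit_eigenvalue_one_degree:
  assumes h: "unit_eigenfunction 1 h" "has_degree h d"
  shows "d = (0, 0)"
proof (rule has_degree_constant[OF h(2)])
  fix C D assume CD: "C \<in> topspace torus" "D \<in> topspace torus"
  have "eigenfunction torus f 1 h" using h(1) by (simp add: unit_eigenfunction_def)
  then show "h C = h D"
    by (rule minimal_mef_invariant_constant[OF compact_space_torus Hausdorff_space_torus homeo minim _ CD])
qed

lemma unit_eigenfunction_on_Y:
  assumes h: "unit_eigenfunction c h"
  obtains k where "eigenfunction Y g c k" "\<And>C. C \<in> topspace torus \<Longrightarrow> k (S `` {C}) = h C"
    "\<And>Q. Q \<in> topspace Y \<Longrightarrow> norm (k Q) = 1"
proof -
  have "eigenfunction torus f c h" using h by (simp add: unit_eigenfunction_def)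
  then obtain k where k: "eigenfunction Y g c k" "\<And>C. C \<in> topspace torus \<Longrightarrow> k (S `` {C}) = h C"
    using eigenfunction_descends[OF bij_f] by metis
  have "norm (k Q) = 1" if "Q \<in> topspace Y" for Q
    using that k(2) h by (auto simp: unit_eigenfunction_def elim!: quotientE)
  with k show ?thesis by (rule that)
qed

lemma g_in_Y: "Q \<in> topspace Y \<Longrightarrow> g Q \<in> topspace Y"
  using bij_g by (auto simp: bij_betw_def)

lemma eigenvalue_norm: "unit_eigenfunction c h \<Longrightarrow> norm c = 1"
  by (simp add: unit_eigenfunction_def eigenfunction_def)

lemma rank_zero:
  assumes "degrees = {(0, 0)}"
  shows "conjugate_systems Y g (discrete_topology {()}) id"
proof -
  have "(C, D) \<in> S" if CD: "C \<in> topspace torus" "D \<in> topspace torus" for C D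
    unfolding S_iff_unit_eigenfunctions
  proof (intro conjI allI impI)
    fix c h d assume h: "unit_eigenfunction c h \<and> has_degree h d"
    then have "d = (0, 0)" using assms by (auto simp: degrees_def)
    then show "h C = h D"
      using h CD by (intro degree_zero_eigenfunction_constant[OF homeo minim])
        (auto simp: unit_eigenfunction_def)
  qed (use CD in auto)
  then have all: "S `` {C} = S `` {D}" if "C \<in> topspace torus" "D \<in> topspace torus" for C D
    using that equiv_class_eq[OF equiv_S] by blast
  have single: "Q = Q'" if "Q \<in> topspace Y" "Q' \<in> topspace Y" for Q Q'
    using that all unfolding topspace_quotient_topology by (metis quotientE)
  show ?thesis
  proof (rule conjugate_systems_via_embeddings[where Z = "discrete_topology {()}" and \<Phi> = "\<lambda>_. ()" and E = id and T = id])
    show "inj_on (\<lambda>_. ()) (topspace Y)" using single by (auto intro: inj_onI)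
    show "(\<lambda>_. ()) ` topspace Y = id ` topspace (discrete_topology {()})" using Y_nonempty by auto
  qed (auto simp: compact_Y compact_space_discrete_topology Hausdorff_space_discrete_topology
      continuous_map_const g_in_Y simp del: topspace_quotient_topology)
qed

text \<open>A unit eigenfunction of degree \<open>u\<close> embeds the factor into the circle, because every other one is a
multiple of a power of it. Its eigenvalue is not a root of unity, so the image contains a dense
orbit of a rotation and, being compact, is the whole circle.\<close>

lemma rank_one:
  assumes u: "u \<in> degrees" "u \<noteq> (0, 0)" and gen: "\<And>d. d \<in> degrees \<Longrightarrow> \<exists>k. d = (k * fst u, k * snd u)"
  shows "\<exists>\<alpha>. \<alpha> \<notin> \<rat> \<and> conjugate_systems Y g circle (circle_rotation \<alpha>)"
proof -
  obtain c h where h: "unit_eigenfunction c h" "has_degree h u"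
    using u(1) by (auto simp: degrees_def)
  obtain k where k: "eigenfunction Y g c k" "\<And>C. C \<in> topspace torus \<Longrightarrow> k (S `` {C}) = h C"
    "\<And>Q. Q \<in> topspace Y \<Longrightarrow> norm (k Q) = 1"
    using unit_eigenfunction_on_Y[OF h(1)] by metis
  have kc: "continuous_map Y euclidean k" using k(1) by (simp add: eigenfunction_def)
  have indep: "m = 0" if "c powi m = 1" for m
  proof -
    have "(m * fst u, m * snd u) = (0, 0)"
      using unit_eigenvalue_one_degree unit_eigenfunction_power_int[OF h(1), of m]
        has_degree_power_int[OF h(2), of m] that by metis
    then show ?thesis using u(2) by (auto simp: prod_eq_iff)
  qed
  have inj: "inj_on k (topspace Y)"
  proof (rule inj_onI)
    fix Q Q' assume Q: "Q \<in> topspace Y" "Q' \<in> topspace Y" "k Q = k Q'"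
    then obtain C D where CD: "Q = S `` {C}" "Q' = S `` {D}" "C \<in> topspace torus" "D \<in> topspace torus"
      by (auto elim!: quotientE)
    then have eq: "h C = h D" using Q(3) k(2) by simp
    have "(C, D) \<in> S"
      unfolding S_iff_unit_eigenfunctions
    proof (intro conjI allI impI)
      fix c' h' d assume h': "unit_eigenfunction c' h' \<and> has_degree h' d"
      then have "d \<in> degrees" by (auto simp: degrees_def)
      then obtain m where m: "d = (m * fst u, m * snd u)" using gen by blast
      show "h' C = h' D"
        by (rule same_degree_proportional[OF unit_eigenfunction_power_int[OF h(1)]
              has_degree_power_int[OF h(2), of m]])
          (use h' m CD eq in auto)
    qed (use CD in auto)
    then show "Q = Q'" using CD equiv_class_eq[OF equiv_S] by simp
  qed
  define Q0 where "Q0 = S `` {torus_rel `` {0}}"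
  have Q0: "Q0 \<in> topspace Y" unfolding Q0_def by (rule Y_nonempty)
  have "compact (k ` topspace Y)"
    using image_compactin[OF _ kc, of "topspace Y"] compact_Y by (simp add: compact_space_def)
  then have clos: "closed (k ` topspace Y)" by (rule compact_imp_closed)
  have "k ` topspace Y = sphere 0 1"
  proof (intro equalityI subsetI)
    fix w assume "w \<in> k ` topspace Y"
    then show "w \<in> sphere 0 1" using k(3) by auto
  next
    fix w :: complex assume w: "w \<in> sphere 0 1"
    have "w \<in> closure (k ` topspace Y)"
      unfolding closure_approachable
    proof (intro allI impI)
      fix e :: real assume "e > 0"
      have "norm (w / k Q0) = 1" using w k(3)[OF Q0] by (simp add: norm_divide)
      then obtain n :: int where n: "norm (c powi n - w / k Q0) < e"
        using dense_powers_circle[OF eigenvalue_norm[OF h(1)] _ indep \<open>e > 0\<close>] by metis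
      have "k Q0 \<noteq> 0" using k(3)[OF Q0] by auto
      then have "c powi n * k Q0 - w = (c powi n - w / k Q0) * k Q0" by (simp add: algebra_simps)
      then have "norm (c powi n * k Q0 - w) < e" using n k(3)[OF Q0] by (simp add: norm_mult)
      then have "dist (k (int_iterate Y g n Q0)) w < e"
        by (simp add: dist_norm eigenfunction_int_iterate[OF k(1) bij_g Q0])
      then show "\<exists>y\<in>k ` topspace Y. dist y w < e"
        using int_iterate_in_topspace[OF bij_g Q0] by blast
    qed
    then show "w \<in> k ` topspace Y" using closure_closed[OF clos] by simp
  qed
  moreover obtain E :: "real set \<Rightarrow> complex" where E: "continuous_map circle euclidean E"
    "inj_on E (topspace circle)" "\<And>x. E (circle_rel `` {x}) = cis (2 * pi * x)" "E ` topspace circle = sphere 0 1"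
    using circle_embedding by metis
  ultimately have im: "k ` topspace Y = E ` topspace circle" by simp
  obtain \<alpha> where \<alpha>: "c = cis (2 * pi * \<alpha>)" using unit_complex_eq_cis_2pi[OF eigenvalue_norm[OF h(1)]] .
  have "conjugate_systems Y g circle (circle_rotation \<alpha>)"
  proof (rule conjugate_systems_via_embeddings[OF compact_Y compact_space_circle _ kc inj E(1,2) im, where T = "\<lambda>z. c * z"])
    fix C assume "C \<in> topspace circle"
    then obtain x where "C = circle_rel `` {x}" by (auto simp: topspace_circle)
    then show "circle_rotation \<alpha> C \<in> topspace circle \<and> E (circle_rotation \<alpha> C) = c * E C"
      by (simp add: circle_rotation_class E(3) \<alpha> cis_mult algebra_simps)
  qed (use k(1) g_in_Y in \<open>auto simp: eigenfunction_def simp del: topspace_quotient_topology\<close>)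
  moreover have "\<alpha> \<notin> \<rat>" using irrational_of_cis[of \<alpha>] indep unfolding \<alpha> by blast
  ultimately show ?thesis by blast
qed

text \<open>The argument for rank one, with a pair of eigenfunctions whose degrees form a basis and with
Kronecker's theorem in two variables.\<close>

lemma rank_two:
  assumes u: "u \<in> degrees" and v: "v \<in> degrees" and det: "fst u * snd v - snd u * fst v \<noteq> 0"
    and gen: "\<And>d. d \<in> degrees \<Longrightarrow> \<exists>k l. d = (k * fst u + l * fst v, k * snd u + l * snd v)"
  shows "\<exists>\<alpha> \<beta>. rationally_independent_with_1 \<alpha> \<beta> \<and> conjugate_systems Y g torus (torus_translation (\<alpha>, \<beta>))"
proof -
  obtain c1 h1 c2 h2 where h1: "unit_eigenfunction c1 h1" "has_degree h1 u"
    and h2: "unit_eigenfunction c2 h2" "has_degree h2 v"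
    using u v by (auto simp: degrees_def)
  obtain k1 where k1: "eigenfunction Y g c1 k1" "\<And>C. C \<in> topspace torus \<Longrightarrow> k1 (S `` {C}) = h1 C"
    "\<And>Q. Q \<in> topspace Y \<Longrightarrow> norm (k1 Q) = 1"
    using unit_eigenfunction_on_Y[OF h1(1)] by metis
  obtain k2 where k2: "eigenfunction Y g c2 k2" "\<And>C. C \<in> topspace torus \<Longrightarrow> k2 (S `` {C}) = h2 C"
    "\<And>Q. Q \<in> topspace Y \<Longrightarrow> norm (k2 Q) = 1"
    using unit_eigenfunction_on_Y[OF h2(1)] by metis
  define \<Phi> where "\<Phi> Q = (k1 Q, k2 Q)" for Q
  have \<Phi>c: "continuous_map Y euclidean \<Phi>"
    using k1(1) k2(1) unfolding \<Phi>_def eigenfunction_def prod_topology_euclidean[symmetric]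
    by (intro continuous_map_pairedI) simp_all
  have unit: "unit_eigenfunction (c1 powi m * c2 powi n) (\<lambda>C. h1 C powi m * h2 C powi n)" for m n
    by (intro unit_eigenfunction_mult unit_eigenfunction_power_int h1 h2)
  have deg: "has_degree (\<lambda>C. h1 C powi m * h2 C powi n) (m * fst u + n * fst v, m * snd u + n * snd v)" for m n
    using has_degree_mult[OF has_degree_power_int[OF h1(2)] has_degree_power_int[OF h2(2)]] by simp
  have indep: "m = 0 \<and> n = 0" if "c1 powi m * c2 powi n = 1" for m n
  proof -
    have "(m * fst u + n * fst v, m * snd u + n * snd v) = (0, 0)"
      by (rule unit_eigenvalue_one_degree[OF _ deg[of m n]]) (use unit[of m n] that in simp)
    then have r: "m * fst u + n * fst v = 0" "m * snd u + n * snd v = 0" by auto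
    \<comment> \<open>Cramer's rule\<close>
    have "m * (fst u * snd v - snd u * fst v) = (m * fst u + n * fst v) * snd v - (m * snd u + n * snd v) * fst v"
      "n * (fst u * snd v - snd u * fst v) = (m * snd u + n * snd v) * fst u - (m * fst u + n * fst v) * snd u"
      by (simp_all add: algebra_simps)
    then have "m * (fst u * snd v - snd u * fst v) = 0" "n * (fst u * snd v - snd u * fst v) = 0"
      unfolding r by simp_all
    then show ?thesis using det unfolding mult_eq_0_iff by blast
  qed
  have inj: "inj_on \<Phi> (topspace Y)"
  proof (rule inj_onI)
    fix Q Q' assume Q: "Q \<in> topspace Y" "Q' \<in> topspace Y" "\<Phi> Q = \<Phi> Q'"
    then obtain C D where CD: "Q = S `` {C}" "Q' = S `` {D}" "C \<in> topspace torus" "D \<in> topspace torus"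
      by (auto elim!: quotientE)
    then have eq: "h1 C = h1 D" "h2 C = h2 D" using Q(3) k1(2) k2(2) by (simp_all add: \<Phi>_def)
    have "(C, D) \<in> S"
      unfolding S_iff_unit_eigenfunctions
    proof (intro conjI allI impI)
      fix c' h' d assume h': "unit_eigenfunction c' h' \<and> has_degree h' d"
      then have "d \<in> degrees" by (auto simp: degrees_def)
      then obtain m n where mn: "d = (m * fst u + n * fst v, m * snd u + n * snd v)"
        using gen by blast
      show "h' C = h' D"
        by (rule same_degree_proportional[OF unit deg[of m n]]) (use h' mn CD eq in auto)
    qed (use CD in auto)
    then show "Q = Q'" using CD equiv_class_eq[OF equiv_S] by simp
  qed
  define Q0 where "Q0 = S `` {torus_rel `` {0}}"
  have Q0: "Q0 \<in> topspace Y" unfolding Q0_def by (rule Y_nonempty)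
  have "compact (\<Phi> ` topspace Y)"
    using image_compactin[OF _ \<Phi>c, of "topspace Y"] compact_Y by (simp add: compact_space_def)
  then have clos: "closed (\<Phi> ` topspace Y)" by (rule compact_imp_closed)
  have "\<Phi> ` topspace Y = sphere 0 1 \<times> sphere 0 1"
  proof (intro equalityI subsetI)
    fix w assume "w \<in> \<Phi> ` topspace Y"
    then show "w \<in> sphere 0 1 \<times> sphere 0 1" using k1(3) k2(3) by (auto simp: \<Phi>_def)
  next
    fix w :: "complex \<times> complex" assume "w \<in> sphere 0 1 \<times> sphere 0 1"
    then obtain w1 w2 where w: "w = (w1, w2)" "norm w1 = 1" "norm w2 = 1" by auto
    have "w \<in> closure (\<Phi> ` topspace Y)"
      unfolding closure_approachable
    proof (intro allI impI)
      fix e :: real assume "e > 0"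
      have "norm (w1 / k1 Q0) = 1" "norm (w2 / k2 Q0) = 1"
        using w k1(3)[OF Q0] k2(3)[OF Q0] by (simp_all add: norm_divide)
      then obtain n :: int where n: "norm (c1 powi n - w1 / k1 Q0) < e / 2" "norm (c2 powi n - w2 / k2 Q0) < e / 2"
        using dense_powers_torus[OF eigenvalue_norm[OF h1(1)] eigenvalue_norm[OF h2(1)] _ _ indep half_gt_zero[OF \<open>e > 0\<close>]]
        by metis
      have "k1 Q0 \<noteq> 0" "k2 Q0 \<noteq> 0" using k1(3)[OF Q0] k2(3)[OF Q0] by auto
      then have "c1 powi n * k1 Q0 - w1 = (c1 powi n - w1 / k1 Q0) * k1 Q0"
        "c2 powi n * k2 Q0 - w2 = (c2 powi n - w2 / k2 Q0) * k2 Q0" by (simp_all add: algebra_simps)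
      then have "norm (c1 powi n * k1 Q0 - w1) < e / 2" "norm (c2 powi n * k2 Q0 - w2) < e / 2"
        using n k1(3)[OF Q0] k2(3)[OF Q0] by (simp_all add: norm_mult)
      then have near: "dist (k1 (int_iterate Y g n Q0)) w1 < e / 2" "dist (k2 (int_iterate Y g n Q0)) w2 < e / 2"
        by (simp_all add: dist_norm eigenfunction_int_iterate[OF k1(1) bij_g Q0] eigenfunction_int_iterate[OF k2(1) bij_g Q0])
      have "dist (\<Phi> (int_iterate Y g n Q0)) w \<le> dist (k1 (int_iterate Y g n Q0)) w1 + dist (k2 (int_iterate Y g n Q0)) w2"
        unfolding \<Phi>_def w(1) dist_Pair_Pair by (rule sqrt_sum_squares_le_sum) simp_all
      then have "dist (\<Phi> (int_iterate Y g n Q0)) w < e" using near by simp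
      then show "\<exists>y\<in>\<Phi> ` topspace Y. dist y w < e"
        using int_iterate_in_topspace[OF bij_g Q0] by blast
    qed
    then show "w \<in> \<Phi> ` topspace Y" using closure_closed[OF clos] by simp
  qed
  moreover obtain E :: "(real \<times> real) set \<Rightarrow> complex \<times> complex" where E: "continuous_map torus euclidean E"
    "inj_on E (topspace torus)" "\<And>x. E (torus_rel `` {x}) = (cis (2 * pi * fst x), cis (2 * pi * snd x))"
    "E ` topspace torus = sphere 0 1 \<times> sphere 0 1"
    using torus_embedding by metis
  ultimately have im: "\<Phi> ` topspace Y = E ` topspace torus" by simp
  obtain \<alpha> where \<alpha>: "c1 = cis (2 * pi * \<alpha>)" using unit_complex_eq_cis_2pi[OF eigenvalue_norm[OF h1(1)]] .
  obtain \<beta> where \<beta>: "c2 = cis (2 * pi * \<beta>)" using unit_complex_eq_cis_2pi[OF eigenvalue_norm[OF h2(1)]] .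
  have "conjugate_systems Y g torus (torus_translation (\<alpha>, \<beta>))"
  proof (rule conjugate_systems_via_embeddings[OF compact_Y compact_space_torus _ \<Phi>c inj E(1,2) im,
        where T = "\<lambda>(z, w). (c1 * z, c2 * w)"])
    fix C assume "C \<in> topspace torus"
    then obtain x where "C = torus_rel `` {x}" by (auto simp: topspace_torus)
    then show "torus_translation (\<alpha>, \<beta>) C \<in> topspace torus \<and>
        E (torus_translation (\<alpha>, \<beta>) C) = (case E C of (z, w) \<Rightarrow> (c1 * z, c2 * w))"
      by (simp add: torus_translation_class E(3) \<alpha> \<beta> cis_mult algebra_simps)
  qed (use k1(1) k2(1) g_in_Y in \<open>auto simp: \<Phi>_def eigenfunction_def simp del: topspace_quotient_topology\<close>)
  moreover have "rationally_independent_with_1 \<alpha> \<beta>"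
    by (rule rationally_independent_of_cis) (use indep in \<open>simp add: \<alpha> \<beta>\<close>)
  ultimately show ?thesis by blast
qed

end

theorem theoremB:
  fixes f :: "(real \<times> real) set \<Rightarrow> (real \<times> real) set"
  assumes "homeomorphic_map torus torus f"
    and "minimal_system (mef_space torus f) (mef_map torus f)"
  shows "(\<exists>\<alpha>\<^sub>1 \<alpha>\<^sub>2. rationally_independent_with_1 \<alpha>\<^sub>1 \<alpha>\<^sub>2 \<and>
            conjugate_systems (mef_space torus f) (mef_map torus f)
              torus (torus_translation (\<alpha>\<^sub>1, \<alpha>\<^sub>2)))
       \<or> (\<exists>\<alpha>. \<alpha> \<notin> \<rat> \<and>
            conjugate_systems (mef_space torus f) (mef_map torus f) circle (circle_rotation \<alpha>))
       \<or> conjugate_systems (mef_space torus f) (mef_map torus f) (discrete_topology {()}) id"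
proof -
  interpret torus_minimal_mef f by (rule torus_minimal_mef.intro) (fact assms)+
  show ?thesis
    unfolding mef_eq
    by (rule int_plane_subgroup_basis[OF degree_zero degrees_diff]) (use rank_zero rank_one rank_two in metis)+
qed

end
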